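(* Let $M$ be a factor of type II$_1$ with unique trace $\tau$, and let $\varphi_1,\dots,\varphi_k$ be normal states on $M$. Let $A$ be a $C^*$-subalgebra of $M$ isomorphic to $M_m(\mathbb C)$ with $1\in A$, where $1$ is the identity of $M$. Then there exists a unitary operator $u\in M$ satisfying $$\varphi_i\circ\mathrm{Ad}\,u\vert_A=\tau\vert_A,\quad i=1,\dots,k.$$
   Context: $\tau$ is the unique normalized (tracial state) trace on $M$; $M_m(\mathbb C)$ is the algebra of complex $m\times m$ matrices. For a unitary $u\in M$, $\mathrm{Ad}\,u$ denotes the inner automorphism $x\mapsto u^*xu$ of $M$. *)

theory Defs
  imports "HOL-Analysis.Analysis"
begin

text \<open>Complex Hilbert spaces. The inner product is linear in its first argument. Positivity and
  definiteness of the inner product follow from the last axiom and the norm axioms, and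
  completeness comes from the class \<^class>\<open>banach\<close>.\<close>

class complex_hilbert = banach +
  fixes scaleC :: "complex \<Rightarrow> 'a \<Rightarrow> 'a"  (infixr "*\<^sub>C" 75)
    and cinner :: "'a \<Rightarrow> 'a \<Rightarrow> complex"
  assumes scaleC_add_right: "c *\<^sub>C (x + y) = c *\<^sub>C x + c *\<^sub>C y"
    and scaleC_add_left: "(c + d) *\<^sub>C x = c *\<^sub>C x + d *\<^sub>C x"
    and scaleC_scaleC: "c *\<^sub>C (d *\<^sub>C x) = (c * d) *\<^sub>C x"
    and scaleR_scaleC: "r *\<^sub>R x = complex_of_real r *\<^sub>C x"
    and cinner_commute: "cinner x y = cnj (cinner y x)"
    and cinner_add_left: "cinner (x + y) z = cinner x z + cinner y z"
    and cinner_scaleC_left: "cinner (c *\<^sub>C x) y = c * cinner x y"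
    and cinner_self: "cinner x x = complex_of_real ((norm x)\<^sup>2)"

lemma norm_scaleC: "norm (c *\<^sub>C x) = cmod c * norm (x :: 'h::complex_hilbert)"
proof -
  have "cinner (c *\<^sub>C x) (c *\<^sub>C x) = c * cnj c * cinner x x"
    by (metis cinner_commute cinner_scaleC_left complex_cnj_mult mult.assoc)
  then have "complex_of_real ((norm (c *\<^sub>C x))\<^sup>2) = complex_of_real ((cmod c * norm x)\<^sup>2)"
    by (simp add: cinner_self complex_norm_square power_mult_distrib flip: of_real_power)
  then have "(norm (c *\<^sub>C x))\<^sup>2 = (cmod c * norm x)\<^sup>2"
    using of_real_eq_iff by blast
  then show ?thesis
    by simp
qed

lemma bounded_linear_scaleC: "bounded_linear (\<lambda>x :: 'h::complex_hilbert. c *\<^sub>C x)"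
proof (rule bounded_linear_intro[where K = "cmod c"])
  show "c *\<^sub>C (r *\<^sub>R x) = r *\<^sub>R (c *\<^sub>C x)" for r and x :: 'h
    by (simp add: scaleR_scaleC scaleC_scaleC mult.commute)
qed (simp_all add: scaleC_add_right norm_scaleC mult.commute)

text \<open>The type \<open>'h \<Rightarrow>\<^sub>L 'h\<close> consists of the bounded real-linear operators, with the operator norm;
  the algebra $B(H)$ is the subset of complex-linear ones.\<close>

type_synonym 'h operator = "'h \<Rightarrow>\<^sub>L 'h"

definition bounded_ops :: "'h::complex_hilbert operator set" where
  "bounded_ops = {T. \<forall>c x. blinfun_apply T (c *\<^sub>C x) = c *\<^sub>C blinfun_apply T x}"

lift_definition scaleC_op :: "complex \<Rightarrow> 'h::complex_hilbert operator \<Rightarrow> 'h operator"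
  is "\<lambda>c T x. c *\<^sub>C T x"
  by (rule bounded_linear_compose[OF bounded_linear_scaleC])

text \<open>Only meaningful on \<open>bounded_ops\<close>, where the adjoint exists and is unique.\<close>

definition cadj :: "'h::complex_hilbert operator \<Rightarrow> 'h operator" where
  "cadj T = (THE S. \<forall>x y. cinner (blinfun_apply T x) y = cinner x (blinfun_apply S y))"

definition commutant :: "'h::complex_hilbert operator set \<Rightarrow> 'h operator set" where
  "commutant S = {T \<in> bounded_ops. \<forall>X\<in>S. T o\<^sub>L X = X o\<^sub>L T}"

definition von_neumann_algebra :: "'h::complex_hilbert operator set \<Rightarrow> bool" where
  "von_neumann_algebra M \<longleftrightarrow>
     M \<subseteq> bounded_ops \<and> (\<forall>x\<in>M. cadj x \<in> M) \<and> commutant (commutant M) = M"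

definition factor :: "'h::complex_hilbert operator set \<Rightarrow> bool" where
  "factor M \<longleftrightarrow> von_neumann_algebra M \<and> M \<inter> commutant M = range (\<lambda>c. scaleC_op c id_blinfun)"

definition is_projection :: "'h::complex_hilbert operator \<Rightarrow> bool" where
  "is_projection p \<longleftrightarrow> p \<in> bounded_ops \<and> p o\<^sub>L p = p \<and> cadj p = p"

definition is_unitary :: "'h::complex_hilbert operator \<Rightarrow> bool" where
  "is_unitary u \<longleftrightarrow> u \<in> bounded_ops \<and> cadj u o\<^sub>L u = id_blinfun \<and> u o\<^sub>L cadj u = id_blinfun"

definition abelian_projection :: "'h::complex_hilbert operator set \<Rightarrow> 'h operator \<Rightarrow> bool" where
  "abelian_projection M p \<longleftrightarrow> p \<in> M \<and> is_projection p \<and>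
     (\<forall>x\<in>M. \<forall>y\<in>M. (p o\<^sub>L x o\<^sub>L p) o\<^sub>L (p o\<^sub>L y o\<^sub>L p) = (p o\<^sub>L y o\<^sub>L p) o\<^sub>L (p o\<^sub>L x o\<^sub>L p))"

text \<open>The identity is a finite projection: it is not Murray-von Neumann equivalent to a proper
  subprojection.\<close>

definition finite_algebra :: "'h::complex_hilbert operator set \<Rightarrow> bool" where
  "finite_algebra M \<longleftrightarrow> (\<forall>v\<in>M. cadj v o\<^sub>L v = id_blinfun \<longrightarrow> v o\<^sub>L cadj v = id_blinfun)"

definition type_II1_factor :: "'h::complex_hilbert operator set \<Rightarrow> bool" where
  "type_II1_factor M \<longleftrightarrow>
     factor M \<and> finite_algebra M \<and> (\<forall>p. abelian_projection M p \<longrightarrow> p = 0)"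

text \<open>Functionals on \<open>M\<close> are functions on all operators of which only the values on \<open>M\<close> matter.\<close>

definition state_on :: "'h::complex_hilbert operator set \<Rightarrow> ('h operator \<Rightarrow> complex) \<Rightarrow> bool" where
  "state_on M \<phi> \<longleftrightarrow>
     (\<forall>x\<in>M. \<forall>y\<in>M. \<phi> (x + y) = \<phi> x + \<phi> y) \<and>
     (\<forall>c. \<forall>x\<in>M. \<phi> (scaleC_op c x) = c * \<phi> x) \<and>
     (\<forall>x\<in>M. \<phi> (cadj x o\<^sub>L x) \<in> \<real>\<^sub>\<ge>\<^sub>0) \<and>
     \<phi> id_blinfun = 1"

definition tracial_state_on :: "'h::complex_hilbert operator set \<Rightarrow> ('h operator \<Rightarrow> complex) \<Rightarrow> bool" where
  "tracial_state_on M \<tau> \<longleftrightarrow> state_on M \<tau> \<and> (\<forall>x\<in>M. \<forall>y\<in>M. \<tau> (x o\<^sub>L y) = \<tau> (y o\<^sub>L x))"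

definition selfadjoint_part :: "'h::complex_hilbert operator set \<Rightarrow> 'h operator set" where
  "selfadjoint_part M = {x \<in> M. cadj x = x}"

text \<open>The order of self-adjoint operators: \<open>T - S\<close> is positive.\<close>

definition op_le :: "'h::complex_hilbert operator \<Rightarrow> 'h operator \<Rightarrow> bool" where
  "op_le S T \<longleftrightarrow> (\<forall>\<xi>. cinner (blinfun_apply (T - S) \<xi>) \<xi> \<in> \<real>\<^sub>\<ge>\<^sub>0)"

definition directed_up :: "'h::complex_hilbert operator set \<Rightarrow> bool" where
  "directed_up D \<longleftrightarrow> D \<noteq> {} \<and> (\<forall>x\<in>D. \<forall>y\<in>D. \<exists>z\<in>D. op_le x z \<and> op_le y z)"

definition is_op_sup :: "'h::complex_hilbert operator set \<Rightarrow> 'h operator set \<Rightarrow> 'h operator \<Rightarrow> bool" where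
  "is_op_sup M D s \<longleftrightarrow> s \<in> selfadjoint_part M \<and> (\<forall>x\<in>D. op_le x s) \<and>
     (\<forall>y\<in>selfadjoint_part M. (\<forall>x\<in>D. op_le x y) \<longrightarrow> op_le s y)"

text \<open>Normality: the state preserves suprema of bounded increasing nets of self-adjoint elements.
  Directed sets replace nets. States are real on self-adjoint elements, so taking \<^const>\<open>Re\<close>
  loses nothing.\<close>

definition normal_state_on :: "'h::complex_hilbert operator set \<Rightarrow> ('h operator \<Rightarrow> complex) \<Rightarrow> bool" where
  "normal_state_on M \<phi> \<longleftrightarrow> state_on M \<phi> \<and>
     (\<forall>D s. D \<subseteq> selfadjoint_part M \<and> directed_up D \<and> is_op_sup M D s \<longrightarrow>
        Re (\<phi> s) = (SUP x\<in>D. Re (\<phi> x)))"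

definition cstar_subalgebra :: "'h::complex_hilbert operator set \<Rightarrow> 'h operator set \<Rightarrow> bool" where
  "cstar_subalgebra A M \<longleftrightarrow> A \<subseteq> M \<and> 0 \<in> A \<and>
     (\<forall>x\<in>A. \<forall>y\<in>A. x + y \<in> A \<and> x o\<^sub>L y \<in> A) \<and>
     (\<forall>c. \<forall>x\<in>A. scaleC_op c x \<in> A) \<and>
     (\<forall>x\<in>A. cadj x \<in> A) \<and>
     closed A"

text \<open>\<open>\<pi>\<close> is a \<open>*\<close>-isomorphism from the algebra of complex matrices indexed by \<open>'m\<close> onto \<open>A\<close>;
  the involution on matrices is the conjugate transpose.\<close>

definition matrix_star_iso ::
    "(complex ^ 'm ^ 'm \<Rightarrow> 'h::complex_hilbert operator) \<Rightarrow> 'h operator set \<Rightarrow> bool" where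
  "matrix_star_iso \<pi> A \<longleftrightarrow> bij_betw \<pi> UNIV A \<and>
     (\<forall>X Y. \<pi> (X + Y) = \<pi> X + \<pi> Y) \<and>
     (\<forall>c X. \<pi> (\<chi> i j. c * X $ i $ j) = scaleC_op c (\<pi> X)) \<and>
     (\<forall>X Y. \<pi> (X ** Y) = \<pi> X o\<^sub>L \<pi> Y) \<and>
     (\<forall>X. \<pi> (\<chi> i j. cnj (X $ j $ i)) = cadj (\<pi> X))"

definition Ad :: "'h::complex_hilbert operator \<Rightarrow> 'h operator \<Rightarrow> 'h operator" where
  "Ad u x = cadj u o\<^sub>L x o\<^sub>L u"

end

theory Submission imports Defs begin

text \<open>Let \<open>U\<^sub>1, \<dots>, U\<^sub>n\<close> be the signed permutation matrices. For every matrix \<open>X\<close> the sum of the conjugates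
  \<open>U\<^sub>j\<^sup>* X U\<^sub>j\<close> is a scalar matrix: averaging over signs kills the off-diagonal entries, averaging over
  permutations equalizes the diagonal. Let \<open>w\<^sub>j \<in> A\<close> be the unitary corresponding to \<open>U\<^sub>j\<close>, and suppose
  that \<open>q\<^sub>1, \<dots>, q\<^sub>n\<close> are orthogonal projections in \<open>M\<close> with sum \<open>1\<close> that commute with \<open>A\<close> and satisfy
  \<open>\<phi>\<^sub>i (q\<^sub>j a) = \<phi>\<^sub>i (a) / n\<close> for all \<open>a \<in> A\<close>. Then \<open>u = \<Sum>\<^sub>j q\<^sub>j w\<^sub>j\<close> is unitary, \<open>u\<^sup>* a u = \<Sum>\<^sub>j q\<^sub>j w\<^sub>j\<^sup>* a w\<^sub>j\<close>,
  and so \<open>\<phi>\<^sub>i (u\<^sup>* a u)\<close> is the average over \<open>j\<close> of \<open>\<phi>\<^sub>i (w\<^sub>j\<^sup>* a w\<^sub>j)\<close>. The average of the \<open>w\<^sub>j\<^sup>* a w\<^sub>j\<close> is a scalar,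
  which any state recovers, and by the trace property this scalar is \<open>\<tau> (a)\<close>
  (\<open>averaging_unitary_exists\<close>).

  The projections \<open>q\<^sub>j\<close> come from a Lyapunov convexity argument in the relative commutant of \<open>A\<close>. As \<open>A\<close> is the
  span of finitely many projections \<open>e\<close>, only the finitely many functionals \<open>x \<mapsto> \<phi>\<^sub>i (x e)\<close> have to be divided
  equally; on projections commuting with \<open>A\<close> they are additive, nonnegative and dominated by the normal
  functional \<open>\<Psi> = \<Sum>\<^sub>i \<phi>\<^sub>i\<close>. They are handled one after the other. If the functionals treated so far
  are proportional along a maximal chain of projections, then normality and the absence of minimal
  projections make the chain a continuous path from \<open>0\<close> to \<open>1\<close>, parametrized by \<open>\<Psi>\<close>
  (\<open>flow_of_splittable\<close>). By the intermediate value theorem the next functional is halved by the increment of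
  the path over some parameter interval of length \<open>1/2\<close>, which also halves all previous ones
  (\<open>halving_of_flow\<close>). At the end, \<open>n\<close> equal parameter steps give the partition
  (\<open>equal_partition_exists\<close>).

  The relative commutant has no minimal projections (\<open>relative_commutant_nonatomic\<close>) because its projections
  correspond to those of a corner of \<open>M\<close>, and a minimal projection \<open>f\<close> of a von Neumann algebra is
  abelian (\<open>minimal_projection_abelian\<close>): for self-adjoint \<open>y\<close> in the corner of \<open>f\<close>, the kernel of \<open>\<bar>y\<bar> + y\<close> in
  the range of \<open>f\<close> is zero or everything, so \<open>y\<close> is definite; applied to \<open>y = z - c f\<close> for real \<open>c\<close>
  this leaves only scalar \<open>z\<close>.\<close>

section \<open>Complex Hilbert spaces and adjoints\<close>

lemma scaleC_one [simp]: "1 *\<^sub>C (x::'h::complex_hilbert) = x"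
  using scaleR_scaleC[of 1 x] by simp

lemma scaleC_minus_one: "(-1) *\<^sub>C (x::'h::complex_hilbert) = - x"
  using scaleR_scaleC[of "-1" x] by simp

lemma scaleC_minus_left: "(- c) *\<^sub>C (x::'h::complex_hilbert) = - (c *\<^sub>C x)"
  using scaleC_scaleC[of "-1" c x] by (simp add: scaleC_minus_one)

lemma cinner_add_right: "cinner (x::'h::complex_hilbert) (y + z) = cinner x y + cinner x z"
  by (metis cinner_add_left cinner_commute complex_cnj_add)

lemma cinner_scaleC_right: "cinner (x::'h::complex_hilbert) (c *\<^sub>C y) = cnj c * cinner x y"
  by (metis cinner_commute cinner_scaleC_left complex_cnj_mult)

lemma cinner_minus_left: "cinner (- x::'h::complex_hilbert) y = - cinner x y"
  using cinner_scaleC_left[of "-1" x y] by (simp add: scaleC_minus_one)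

lemma cinner_minus_right: "cinner (x::'h::complex_hilbert) (- y) = - cinner x y"
  using cinner_scaleC_right[of x "-1" y] by (simp add: scaleC_minus_one)

lemma cinner_diff_left: "cinner (x - y::'h::complex_hilbert) z = cinner x z - cinner y z"
  using cinner_add_left[of x "-y" z] by (simp add: cinner_minus_left)

lemma cinner_diff_right: "cinner (x::'h::complex_hilbert) (y - z) = cinner x y - cinner x z"
  using cinner_add_right[of x y "-z"] by (simp add: cinner_minus_right)

lemma cinner_zero_left [simp]: "cinner (0::'h::complex_hilbert) y = 0"
  using cinner_diff_left[of 0 0 y] by simp

lemma cinner_zero_right [simp]: "cinner (y::'h::complex_hilbert) 0 = 0"
  using cinner_diff_right[of y 0 0] by simp

lemmas cinner_simps = cinner_add_left cinner_add_right cinner_diff_left cinner_diff_right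
  cinner_minus_left cinner_minus_right cinner_scaleC_left cinner_scaleC_right

lemma scaleC_diff_right: "c *\<^sub>C (x - y::'h::complex_hilbert) = c *\<^sub>C x - c *\<^sub>C y"
  using linear_diff[OF bounded_linear.linear[OF bounded_linear_scaleC[of c]]] .

lemma scaleC_zero_right [simp]: "c *\<^sub>C (0::'h::complex_hilbert) = 0"
  using scaleC_diff_right[of c 0 0] by simp

lemma norm_sq_add: "(norm (x + y::'h::complex_hilbert))\<^sup>2 = (norm x)\<^sup>2 + (norm y)\<^sup>2 + 2 * Re (cinner x y)"
proof -
  have "cinner (x + y) (x + y) = cinner x x + cinner y y + (cinner x y + cnj (cinner x y))"
    using cinner_commute[of y x] by (simp add: cinner_simps)
  then have "complex_of_real ((norm (x + y))\<^sup>2)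
      = complex_of_real ((norm x)\<^sup>2 + (norm y)\<^sup>2 + 2 * Re (cinner x y))"
    by (simp add: cinner_self complex_add_cnj)
  then show ?thesis
    using of_real_eq_iff by blast
qed

lemma norm_sq_diff: "(norm (x - y::'h::complex_hilbert))\<^sup>2 = (norm x)\<^sup>2 + (norm y)\<^sup>2 - 2 * Re (cinner x y)"
  using norm_sq_add[of x "-y"] by (simp add: cinner_minus_right)

lemma parallelogram:
  "(norm (x + y::'h::complex_hilbert))\<^sup>2 + (norm (x - y))\<^sup>2 = 2 * (norm x)\<^sup>2 + 2 * (norm y)\<^sup>2"
  by (simp add: norm_sq_add norm_sq_diff)

text \<open>The norm is already known to satisfy the triangle inequality, so the Cauchy-Schwarz
  inequality is read off from the expansion of $\|x+y\|^2$.\<close>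

lemma Re_cinner_le: "Re (cinner (x::'h::complex_hilbert) y) \<le> norm x * norm y"
proof -
  have "(norm (x + y))\<^sup>2 \<le> (norm x + norm y)\<^sup>2"
    by (simp add: norm_triangle_ineq power_mono)
  then show ?thesis
    by (simp add: norm_sq_add power2_sum)
qed

lemma Cauchy_Schwarz: "cmod (cinner (x::'h::complex_hilbert) y) \<le> norm x * norm y"
proof (cases "cinner x y = 0")
  case False
  define c where "c = cnj (sgn (cinner x y))"
  have 1: "cmod c = 1"
    using False by (simp add: c_def norm_sgn)
  have "c * cinner x y = complex_of_real (cmod (cinner x y))"
    using False complex_norm_square[of "cinner x y"]
    by (simp add: c_def sgn_eq power2_eq_square field_simps)
  then have "cmod (cinner x y) = Re (cinner (c *\<^sub>C x) y)"
    by (simp add: cinner_scaleC_left)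
  also have "\<dots> \<le> norm x * norm y"
    using Re_cinner_le[of "c *\<^sub>C x" y] by (simp add: norm_scaleC 1)
  finally show ?thesis .
qed simp

lemma bounded_linear_cinner_left: "bounded_linear (\<lambda>x::'h::complex_hilbert. cinner x y)"
  by (rule bounded_linear_intro[where K = "norm y"])
    (simp_all add: cinner_add_left scaleR_scaleC cinner_scaleC_left Cauchy_Schwarz scaleR_conv_of_real)

lemma bounded_linear_cinner_right: "bounded_linear (\<lambda>x::'h::complex_hilbert. cinner y x)"
  by (rule bounded_linear_intro[where K = "norm y"])
    (simp_all add: cinner_add_right scaleR_scaleC cinner_scaleC_right scaleR_conv_of_real
      mult.commute[of "norm _" "norm y"] Cauchy_Schwarz)

lemma cinner_ext: 
  assumes "\<And>z. cinner z (x::'h::complex_hilbert) = cinner z y" shows "x = y"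
proof -
  have "cinner (x - y) (x - y) = 0"
    using assms by (simp add: cinner_diff_right)
  then show ?thesis
    by (simp add: cinner_self)
qed

definition closed_csubspace :: "'h::complex_hilbert set \<Rightarrow> bool" where
  "closed_csubspace V \<longleftrightarrow> closed V \<and> 0 \<in> V \<and> (\<forall>x\<in>V. \<forall>y\<in>V. x + y \<in> V) \<and> (\<forall>c. \<forall>x\<in>V. c *\<^sub>C x \<in> V)"

lemma closed_csubspace_scaleR:
  assumes "closed_csubspace V" "x \<in> V" shows "r *\<^sub>R x \<in> V"
  using assms by (simp add: closed_csubspace_def scaleR_scaleC)

lemma closed_csubspace_diff:
  assumes "closed_csubspace V" "x \<in> V" "y \<in> V" shows "x - y \<in> V"
proof -
  have "x + (-1) *\<^sub>C y \<in> V"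
    using assms by (simp add: closed_csubspace_def)
  then show ?thesis
    by (simp add: scaleC_minus_one)
qed

text \<open>A minimizing sequence for the distance from \<open>x\<close> to \<open>V\<close> is Cauchy by the parallelogram law,
  and at its limit \<open>v\<close> a first-order variation in the direction of \<open>\<langle>x - v, w\<rangle> w\<close> must vanish.\<close>

lemma orthogonal_decomposition_exists:
  fixes x :: "'h::complex_hilbert"
  assumes V: "closed_csubspace V"
  shows "\<exists>v\<in>V. \<forall>w\<in>V. cinner (x - v) w = 0"
proof -
  define d where "d = (INF w\<in>V. (norm (x - w))\<^sup>2)"
  have bdd: "bdd_below ((\<lambda>w. (norm (x - w))\<^sup>2) ` V)"
    by (rule bdd_belowI[of _ 0]) auto
  have ne: "V \<noteq> {}"
    using V by (auto simp: closed_csubspace_def)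
  have d_le: "d \<le> (norm (x - w))\<^sup>2" if "w \<in> V" for w
    unfolding d_def by (rule cINF_lower[OF bdd that])
  have "\<exists>w\<in>V. (norm (x - w))\<^sup>2 < d + inverse (real (Suc n))" for n
  proof -
    have "d < d + inverse (real (Suc n))"
      by simp
    then show ?thesis
      unfolding d_def using cINF_less_iff[OF ne bdd] by blast
  qed
  then obtain s where sV: "\<And>n. s n \<in> V" and s: "\<And>n. (norm (x - s n))\<^sup>2 < d + inverse (real (Suc n))"
    by metis
  have dist_s: "(norm (s m - s n))\<^sup>2 \<le> 2 * inverse (real (Suc m)) + 2 * inverse (real (Suc n))" for m n
  proof -
    have mid: "(1/2) *\<^sub>R (s m + s n) \<in> V"
      by (rule closed_csubspace_scaleR[OF V]) (use V sV in \<open>simp add: closed_csubspace_def\<close>)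
    have "(x - s n) + (x - s m) = 2 *\<^sub>R (x - (1/2) *\<^sub>R (s m + s n))"
      by (simp add: algebra_simps scaleR_2)
    then have "(norm ((x - s n) + (x - s m)))\<^sup>2 = 4 * (norm (x - (1/2) *\<^sub>R (s m + s n)))\<^sup>2"
      by (simp add: power_mult_distrib)
    then have "4 * d \<le> (norm ((x - s n) + (x - s m)))\<^sup>2"
      using d_le[OF mid] by simp
    moreover have "(norm ((x - s n) + (x - s m)))\<^sup>2 + (norm (s m - s n))\<^sup>2
        = 2 * (norm (x - s n))\<^sup>2 + 2 * (norm (x - s m))\<^sup>2"
      using parallelogram[of "x - s n" "x - s m"] by simp
    ultimately show ?thesis
      using s[of m] s[of n] by linarith
  qed
  have "Cauchy s"
  proof (rule metric_CauchyI)
    fix e :: real assume e: "e > 0"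
    obtain N where N: "inverse (real (Suc N)) < e\<^sup>2 / 4"
      using reals_Archimedean[of "e\<^sup>2 / 4"] e by auto
    show "\<exists>N. \<forall>m\<ge>N. \<forall>n\<ge>N. dist (s m) (s n) < e"
    proof (intro exI allI impI)
      fix m n assume mn: "N \<le> m" "N \<le> n"
      have "inverse (real (Suc m)) \<le> inverse (real (Suc N))" "inverse (real (Suc n)) \<le> inverse (real (Suc N))"
        using mn by (simp_all add: le_imp_inverse_le)
      then have "(norm (s m - s n))\<^sup>2 < e\<^sup>2"
        using dist_s[of m n] N by linarith
      then show "dist (s m) (s n) < e"
        using e by (simp add: dist_norm power_less_imp_less_base)
    qed
  qed
  then obtain v where v: "s \<longlonglongrightarrow> v"
    using Cauchy_convergent_iff convergent_def by blast
  have vV: "v \<in> V"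
    using V sV v closed_sequentially closed_csubspace_def by blast
  have vd: "(norm (x - v))\<^sup>2 \<le> d"
  proof (rule LIMSEQ_le)
    show "(\<lambda>n. (norm (x - s n))\<^sup>2) \<longlonglongrightarrow> (norm (x - v))\<^sup>2"
      by (intro tendsto_intros v)
    show "(\<lambda>n. d + inverse (real (Suc n))) \<longlonglongrightarrow> d"
      using tendsto_add[OF tendsto_const LIMSEQ_inverse_real_of_nat, of d] by simp
  qed (use s less_imp_le in blast)
  have "cinner (x - v) w = 0" if w: "w \<in> V" for w
  proof (rule ccontr)
    assume ne0: "cinner (x - v) w \<noteq> 0"
    define c where "c = cinner (x - v) w"
    define t where "t = 1 / ((norm w)\<^sup>2 + 1)"
    have t0: "t > 0"
      by (simp add: t_def add_nonneg_pos)
    have "v + (of_real t * c) *\<^sub>C w \<in> V"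
      using V vV w by (simp add: closed_csubspace_def)
    then have "(norm (x - v))\<^sup>2 \<le> (norm ((x - v) - (of_real t * c) *\<^sub>C w))\<^sup>2"
      using d_le vd by (metis diff_diff_eq order_trans)
    also have "\<dots> = (norm (x - v))\<^sup>2 + (t * cmod c * norm w)\<^sup>2 - 2 * (t * (cmod c)\<^sup>2)"
    proof -
      have "cinner (x - v) ((of_real t * c) *\<^sub>C w) = of_real (t * (cmod c)\<^sup>2)"
        using complex_norm_square[of c] by (simp add: cinner_scaleC_right c_def[symmetric] ac_simps)
      then show ?thesis
        using t0 by (simp add: norm_sq_diff norm_scaleC norm_mult)
    qed
    finally have "2 * (t * (cmod c)\<^sup>2) \<le> t * (cmod c)\<^sup>2 * (t * (norm w)\<^sup>2)"
      by (simp add: power_mult_distrib power2_eq_square ac_simps)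
    moreover have "t * (norm w)\<^sup>2 \<le> 1"
      by (simp add: t_def pos_divide_le_eq add_nonneg_pos)
    moreover have "t * (cmod c)\<^sup>2 > 0"
      using ne0 t0 by (simp add: c_def)
    ultimately show False
      using mult_left_mono[of "t * (norm w)\<^sup>2" 1 "t * (cmod c)\<^sup>2"] by linarith
  qed
  then show ?thesis
    using vV by blast
qed

text \<open>The kernel of a nonzero functional has codimension one, so a suitable multiple of any nonzero
  vector orthogonal to it represents the functional.\<close>

lemma riesz_representation:
  fixes F :: "'h::complex_hilbert \<Rightarrow> complex"
  assumes F: "bounded_linear F" and Fc: "\<And>c x. F (c *\<^sub>C x) = c * F x"
  shows "\<exists>y. \<forall>x. F x = cinner x y"
proof (cases "\<forall>x. F x = 0")
  case True
  then show ?thesis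
    by (intro exI[of _ 0]) simp
next
  case False
  then obtain x0 where x0: "F x0 \<noteq> 0"
    by blast
  interpret F: bounded_linear F by fact
  have "closed {x. F x = 0}"
    by (intro closed_Collect_eq F.continuous_on continuous_on_id continuous_on_const)
  then have "closed_csubspace {x. F x = 0}"
    by (simp add: closed_csubspace_def Fc F.add)
  from orthogonal_decomposition_exists[OF this, of x0]
  obtain v where v: "F v = 0" and vo: "\<And>w. F w = 0 \<Longrightarrow> cinner (x0 - v) w = 0"
    by blast
  define z where "z = x0 - v"
  have Fz: "F z \<noteq> 0"
    using x0 v by (simp add: z_def F.diff)
  then have z0: "cinner z z \<noteq> 0"
    by (auto simp: cinner_self)
  have "F x = cinner x (cnj (F z / cinner z z) *\<^sub>C z)" for x
  proof -
    have "F (x - (F x / F z) *\<^sub>C z) = 0"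
      using Fz by (simp add: F.diff Fc)
    then have "cinner z (x - (F x / F z) *\<^sub>C z) = 0"
      unfolding z_def by (rule vo)
    then have "cinner (x - (F x / F z) *\<^sub>C z) z = 0"
      by (metis cinner_commute complex_cnj_zero)
    then show ?thesis
      using Fz z0 by (simp add: cinner_simps field_simps)
  qed
  then show ?thesis
    by blast
qed

lemma bounded_opsD: "T \<in> bounded_ops \<Longrightarrow> blinfun_apply T (c *\<^sub>C x) = c *\<^sub>C blinfun_apply T x"
  by (simp add: bounded_ops_def)

text \<open>The Riesz vectors \<open>S y\<close> of the functionals \<open>x \<mapsto> \<langle>T x, y\<rangle>\<close> depend linearly on \<open>y\<close>, and
  $\|S y\|^2 = \langle T S y, y\rangle \le \|T\| \|S y\| \|y\|$ bounds them.\<close>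

lemma adjoint_exists:
  assumes T: "T \<in> bounded_ops"
  shows "\<exists>S. \<forall>x y. cinner (blinfun_apply T x) y = cinner x (blinfun_apply S y)"
proof -
  have "\<exists>z. \<forall>x. cinner (blinfun_apply T x) y = cinner x z" for y
    by (rule riesz_representation)
      (auto intro: bounded_linear_compose[OF bounded_linear_cinner_left blinfun.bounded_linear_right]
        simp: bounded_opsD[OF T] cinner_scaleC_left)
  then obtain S where S: "\<And>x y. cinner (blinfun_apply T x) y = cinner x (S y)"
    by metis
  have "bounded_linear S"
  proof (rule bounded_linear_intro[where K = "norm T"])
    show "S (x + y) = S x + S y" for x y
      by (rule cinner_ext) (simp add: S[symmetric] cinner_add_right)
    show "S (r *\<^sub>R x) = r *\<^sub>R S x" for r x
      by (rule cinner_ext) (simp add: S[symmetric] cinner_scaleC_right scaleR_scaleC)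
    show "norm (S y) \<le> norm y * norm T" for y
    proof (cases "S y = 0")
      case False
      have "(norm (S y))\<^sup>2 = cmod (cinner (S y) (S y))"
        by (simp add: cinner_self norm_power)
      also have "\<dots> = cmod (cinner (blinfun_apply T (S y)) y)"
        by (simp add: S)
      also have "\<dots> \<le> norm T * norm (S y) * norm y"
        by (rule order_trans[OF Cauchy_Schwarz])
          (simp add: mult_right_mono norm_blinfun)
      finally show ?thesis
        using False by (simp add: power2_eq_square ac_simps)
    qed simp
  qed
  then show ?thesis
    by (intro exI[of _ "Blinfun S"]) (simp add: bounded_linear_Blinfun_apply S)
qed

lemma cadj_eqI:
  assumes "\<And>x y. cinner (blinfun_apply T x) y = cinner x (blinfun_apply S y)"
  shows "cadj T = S"
  unfolding cadj_def
proof (rule the_equality)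
  fix R assume R: "\<forall>x y. cinner (blinfun_apply T x) y = cinner x (blinfun_apply R y)"
  show "R = S"
    by (rule blinfun_eqI, rule cinner_ext) (use R assms in metis)
qed (use assms in blast)

lemma cinner_cadj:
  assumes "T \<in> bounded_ops"
  shows "cinner (blinfun_apply T x) y = cinner x (blinfun_apply (cadj T) y)"
  using adjoint_exists[OF assms] cadj_eqI by metis

lemma cinner_cadj':
  assumes "T \<in> bounded_ops"
  shows "cinner (blinfun_apply (cadj T) x) y = cinner x (blinfun_apply T y)"
  using cinner_cadj[OF assms, of y x] cinner_commute[of "blinfun_apply (cadj T) x" y]
    cinner_commute[of x "blinfun_apply T y"] by simp

lemma scaleC_op_apply [simp]: "blinfun_apply (scaleC_op c T) x = c *\<^sub>C blinfun_apply T x"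
  by (simp add: scaleC_op.rep_eq)

lemma scaleR_op: "r *\<^sub>R T = scaleC_op (complex_of_real r) (T :: 'h::complex_hilbert operator)"
  by (rule blinfun_eqI) (simp add: blinfun.scaleR_left scaleR_scaleC)

lemma bounded_ops_closure:
  "S \<in> bounded_ops \<Longrightarrow> T \<in> bounded_ops \<Longrightarrow> S + T \<in> bounded_ops"
  "S \<in> bounded_ops \<Longrightarrow> T \<in> bounded_ops \<Longrightarrow> S - T \<in> bounded_ops"
  "S \<in> bounded_ops \<Longrightarrow> T \<in> bounded_ops \<Longrightarrow> S o\<^sub>L T \<in> bounded_ops"
  "T \<in> bounded_ops \<Longrightarrow> scaleC_op c T \<in> bounded_ops"
  by (auto simp: bounded_ops_def blinfun.bilinear_simps scaleC_add_right scaleC_diff_right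
      scaleC_scaleC mult.commute)

lemma bounded_ops_zero_id [simp]: "0 \<in> bounded_ops" "id_blinfun \<in> bounded_ops"
  by (auto simp: bounded_ops_def)

lemma cadj_bounded:
  assumes T: "T \<in> bounded_ops" shows "cadj T \<in> bounded_ops"
  unfolding bounded_ops_def mem_Collect_eq
proof (intro allI, rule cinner_ext)
  fix c x z
  show "cinner z (blinfun_apply (cadj T) (c *\<^sub>C x)) = cinner z (c *\<^sub>C blinfun_apply (cadj T) x)"
    by (simp only: cinner_cadj[OF T, symmetric] cinner_scaleC_right)
qed

lemma cadj_cadj: "T \<in> bounded_ops \<Longrightarrow> cadj (cadj T) = T"
  by (rule cadj_eqI) (rule cinner_cadj')

lemma cadj_compose: "S \<in> bounded_ops \<Longrightarrow> T \<in> bounded_ops \<Longrightarrow> cadj (S o\<^sub>L T) = cadj T o\<^sub>L cadj S"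
  by (rule cadj_eqI) (simp add: cinner_cadj)

lemma cadj_add: "S \<in> bounded_ops \<Longrightarrow> T \<in> bounded_ops \<Longrightarrow> cadj (S + T) = cadj S + cadj T"
  by (rule cadj_eqI) (simp add: cinner_cadj blinfun.bilinear_simps cinner_simps)

lemma cadj_diff: "S \<in> bounded_ops \<Longrightarrow> T \<in> bounded_ops \<Longrightarrow> cadj (S - T) = cadj S - cadj T"
  by (rule cadj_eqI) (simp add: cinner_cadj blinfun.bilinear_simps cinner_simps)

lemma cadj_scaleC: "T \<in> bounded_ops \<Longrightarrow> cadj (scaleC_op c T) = scaleC_op (cnj c) (cadj T)"
  by (rule cadj_eqI) (simp add: cinner_cadj cinner_simps)

lemma cadj_zero [simp]: "cadj 0 = 0" and cadj_id [simp]: "cadj id_blinfun = id_blinfun"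
  by (auto intro!: cadj_eqI)

section \<open>Projections and von Neumann algebras\<close>

lemma compose_assoc: "(R o\<^sub>L S) o\<^sub>L T = R o\<^sub>L (S o\<^sub>L (T :: 'h::complex_hilbert operator))"
  by (rule blinfun_eqI) simp

lemma compose_simps:
  fixes R S T :: "'h::complex_hilbert operator"
  shows "(R + S) o\<^sub>L T = (R o\<^sub>L T) + (S o\<^sub>L T)" "T o\<^sub>L (R + S) = (T o\<^sub>L R) + (T o\<^sub>L S)"
    "(R - S) o\<^sub>L T = (R o\<^sub>L T) - (S o\<^sub>L T)" "T o\<^sub>L (R - S) = (T o\<^sub>L R) - (T o\<^sub>L S)"
    "0 o\<^sub>L T = 0" "T o\<^sub>L 0 = 0" "T o\<^sub>L id_blinfun = T" "id_blinfun o\<^sub>L T = T"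
    "scaleC_op c R o\<^sub>L T = scaleC_op c (R o\<^sub>L T)"
  by (auto intro!: blinfun_eqI simp: blinfun.bilinear_simps)

lemma compose_scaleC_right: "T \<in> bounded_ops \<Longrightarrow> T o\<^sub>L scaleC_op c R = scaleC_op c (T o\<^sub>L R)"
  by (rule blinfun_eqI) (simp add: bounded_opsD)

lemma compose_sum:
  fixes T :: "'h::complex_hilbert operator"
  shows "(\<Sum>i\<in>I. f i) o\<^sub>L T = (\<Sum>i\<in>I. f i o\<^sub>L T)" "T o\<^sub>L (\<Sum>i\<in>I. f i) = (\<Sum>i\<in>I. T o\<^sub>L f i)"
  by (induction I rule: infinite_finite_induct) (simp_all add: compose_simps)

lemma is_projection_apply:
  assumes "is_projection p"
  shows "p \<in> bounded_ops" "blinfun_apply p (blinfun_apply p x) = blinfun_apply p x"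
    "cinner (blinfun_apply p x) y = cinner x (blinfun_apply p y)"
    "cinner (blinfun_apply p x) x = complex_of_real ((norm (blinfun_apply p x))\<^sup>2)"
proof -
  show b: "p \<in> bounded_ops" and 1: "blinfun_apply p (blinfun_apply p x) = blinfun_apply p x" for x
    using assms blinfun_apply_blinfun_compose[of p p x] by (simp_all add: is_projection_def)
  show 2: "cinner (blinfun_apply p x) y = cinner x (blinfun_apply p y)" for x y
    using cinner_cadj[OF b, of x y] assms by (simp add: is_projection_def)
  show "cinner (blinfun_apply p x) x = complex_of_real ((norm (blinfun_apply p x))\<^sup>2)"
    using 2[of "blinfun_apply p x" x] 1 by (simp add: cinner_self)
qed

lemma norm_projection_le:
  assumes "is_projection p"
  shows "norm (blinfun_apply p x) \<le> norm x"
proof (cases "blinfun_apply p x = 0")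
  case False
  have "(norm (blinfun_apply p x))\<^sup>2 = Re (cinner (blinfun_apply p x) x)"
    using is_projection_apply(4)[OF assms, of x] by simp
  also have "\<dots> \<le> norm (blinfun_apply p x) * norm x"
    by (rule Re_cinner_le)
  finally show ?thesis
    using False by (simp add: power2_eq_square)
qed simp

lemma op_le_refl: "op_le S S"
  by (simp add: op_le_def)

lemma op_le_trans: "op_le R S \<Longrightarrow> op_le S T \<Longrightarrow> op_le R T"
proof -
  assume "op_le R S" "op_le S T"
  then have "cinner (blinfun_apply (S - R) x) x + cinner (blinfun_apply (T - S) x) x \<in> \<real>\<^sub>\<ge>\<^sub>0" for x
    by (intro nonneg_Reals_add_I) (auto simp: op_le_def)
  then show ?thesis
    by (simp add: op_le_def blinfun.bilinear_simps cinner_diff_left)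
qed

lemma op_le_add: "op_le S T \<Longrightarrow> op_le (S + R) (T + R)"
  by (simp add: op_le_def)

lemma op_le_flip: "op_le S T \<Longrightarrow> op_le (R - T) (R - S)"
  by (simp add: op_le_def)

lemma projection_nonneg: "is_projection p \<Longrightarrow> op_le 0 p"
  by (simp add: op_le_def is_projection_apply(4) nonneg_Reals_of_real_iff del: of_real_power)

lemma projection_diff:
  assumes p: "is_projection p" and q: "is_projection q" and pq: "p o\<^sub>L q = q"
  shows "is_projection (p - q)"
proof -
  have b: "p \<in> bounded_ops" "q \<in> bounded_ops" and idem: "p o\<^sub>L p = p" "q o\<^sub>L q = q"
    using p q by (auto simp: is_projection_def)
  have "q o\<^sub>L p = cadj (p o\<^sub>L q)"
    using p q b by (simp add: cadj_compose) (simp add: is_projection_def)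
  also have "\<dots> = q"
    using q pq by (simp add: is_projection_def)
  finally have "(p - q) o\<^sub>L (p - q) = p - q"
    using pq idem by (simp add: compose_simps)
  then show ?thesis
    using p q b by (simp add: is_projection_def bounded_ops_closure cadj_diff)
qed

text \<open>The order of projections is inclusion of ranges: if \<open>op_le q p\<close> then the quadratic form of \<open>q\<close>
  vanishes on the kernel of \<open>p\<close>, so \<open>q\<close> vanishes there.\<close>

lemma projection_le_iff:
  assumes p: "is_projection p" and q: "is_projection q"
  shows "op_le q p \<longleftrightarrow> p o\<^sub>L q = q"
proof
  assume le: "op_le q p"
  have "blinfun_apply q (blinfun_apply p x) = blinfun_apply q x" for x
  proof -
    let ?y = "x - blinfun_apply p x"
    have py: "blinfun_apply p ?y = 0"
      by (simp add: blinfun.diff_right is_projection_apply[OF p])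
    have "cinner (blinfun_apply (p - q) ?y) ?y \<in> \<real>\<^sub>\<ge>\<^sub>0"
      using le by (simp add: op_le_def)
    then have "- complex_of_real ((norm (blinfun_apply q ?y))\<^sup>2) \<in> \<real>\<^sub>\<ge>\<^sub>0"
      by (simp add: blinfun.diff_left py cinner_minus_left is_projection_apply(4)[OF q])
    then have "complex_of_real (- (norm (blinfun_apply q ?y))\<^sup>2) \<in> \<real>\<^sub>\<ge>\<^sub>0"
      by simp
    then have "blinfun_apply q ?y = 0"
      unfolding nonneg_Reals_of_real_iff by simp
    then show ?thesis
      by (simp add: blinfun.diff_right)
  qed
  then have "q o\<^sub>L p = q"
    by (intro blinfun_eqI) simp
  moreover have "cadj (q o\<^sub>L p) = p o\<^sub>L q"
    using p q by (simp add: is_projection_def cadj_compose)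
  ultimately show "p o\<^sub>L q = q"
    using q by (simp add: is_projection_def)
next
  assume "p o\<^sub>L q = q"
  then have "op_le 0 (p - q)"
    by (intro projection_nonneg projection_diff p q)
  then show "op_le q p"
    by (simp add: op_le_def)
qed

lemma projection_le_commute:
  assumes "is_projection p" "is_projection q" "op_le q p"
  shows "p o\<^sub>L q = q" "q o\<^sub>L p = q"
proof -
  show 1: "p o\<^sub>L q = q"
    using assms projection_le_iff by blast
  then have "cadj (p o\<^sub>L q) = q"
    using assms by (simp add: is_projection_def)
  then show "q o\<^sub>L p = q"
    using assms by (simp add: is_projection_def cadj_compose)
qed

lemma projection_le_antisym:
  assumes "is_projection p" "is_projection q" "op_le p q" "op_le q p"
  shows "p = q"
  using projection_le_commute[OF assms(1,2,4)] projection_le_commute[OF assms(2,1,3)] by simp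

text \<open>By the orthogonal decomposition every closed subspace is the range of a projection. An
  operator that leaves the subspace invariant together with its adjoint commutes with it.\<close>

lemma projection_onto_exists:
  fixes V :: "'h::complex_hilbert set"
  assumes V: "closed_csubspace V"
  shows "\<exists>p. is_projection p \<and> (\<forall>x. blinfun_apply p x \<in> V) \<and> (\<forall>x\<in>V. blinfun_apply p x = x)"
proof -
  obtain f where fV: "\<And>x. f x \<in> V" and f: "\<And>x w. w \<in> V \<Longrightarrow> cinner (x - f x) w = 0"
    using orthogonal_decomposition_exists[OF V] by metis
  have uniq: "f x = v" if v: "v \<in> V" and o: "\<And>w. w \<in> V \<Longrightarrow> cinner (x - v) w = 0" for x v
  proof -
    have "f x - v \<in> V"
      using closed_csubspace_diff[OF V fV v] .
    then have "cinner (x - v) (f x - v) - cinner (x - f x) (f x - v) = 0"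
      using f o by simp
    then have "cinner (f x - v) (f x - v) = 0"
      by (simp add: cinner_diff_left)
    then show ?thesis
      by (simp add: cinner_self)
  qed
  have sc: "f (c *\<^sub>C x) = c *\<^sub>C f x" for c x
    by (rule uniq) (use V fV f in \<open>auto simp: closed_csubspace_def scaleC_diff_right[symmetric] cinner_scaleC_left\<close>)
  have id: "f x = x" if "x \<in> V" for x
    by (rule uniq) (use that in auto)
  have sym: "cinner (f x) y = cinner x (f y)" for x y
  proof -
    have "cinner (x - f x) (f y) = 0" "cinner (y - f y) (f x) = 0"
      using f fV by auto
    then have "cinner x (f y) = cinner (f x) (f y)" "cinner (f x) (y - f y) = 0"
      using cinner_commute[of "f x" "y - f y"] by (auto simp: cinner_diff_left)
    then show ?thesis
      by (simp add: cinner_diff_right)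
  qed
  have bl: "bounded_linear f"
  proof (rule bounded_linear_intro[where K = 1])
    show "f (x + y) = f x + f y" for x y
    proof (rule uniq)
      show "f x + f y \<in> V"
        using V fV by (auto simp: closed_csubspace_def)
      fix w assume "w \<in> V"
      then have "cinner (x - f x) w + cinner (y - f y) w = 0"
        using f by simp
      then show "cinner (x + y - (f x + f y)) w = 0"
        by (simp add: cinner_add_left cinner_diff_left algebra_simps)
    qed
    show "f (r *\<^sub>R x) = r *\<^sub>R f x" for r x
      by (simp add: scaleR_scaleC sc)
    show "norm (f x) \<le> norm x * 1" for x
    proof (cases "f x = 0")
      case False
      have "complex_of_real ((norm (f x))\<^sup>2) = cinner x (f x)"
        using sym[of "f x" x] id[OF fV] sym[of x x] cinner_self[of "f x"] sym[of x "f x"] by metis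
      then have "(norm (f x))\<^sup>2 = Re (cinner x (f x))"
        by (metis Re_complex_of_real)
      also have "\<dots> \<le> norm x * norm (f x)"
        by (rule Re_cinner_le)
      finally show ?thesis
        using False by (simp add: power2_eq_square)
    qed simp
  qed
  have app: "blinfun_apply (Blinfun f) = f"
    by (rule bounded_linear_Blinfun_apply[OF bl])
  have "is_projection (Blinfun f)"
    unfolding is_projection_def
  proof (intro conjI)
    show "Blinfun f \<in> bounded_ops"
      by (simp add: bounded_ops_def app sc)
    show "Blinfun f o\<^sub>L Blinfun f = Blinfun f"
      by (rule blinfun_eqI) (simp add: app id fV)
    show "cadj (Blinfun f) = Blinfun f"
      by (rule cadj_eqI) (simp add: app sym)
  qed
  then show ?thesis
    using fV id by (intro exI[of _ "Blinfun f"]) (simp add: app)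
qed

lemma projection_commutes:
  assumes p: "is_projection p" and T: "T \<in> bounded_ops"
    and V: "\<And>x. blinfun_apply p x \<in> V" "\<And>x. x \<in> V \<Longrightarrow> blinfun_apply p x = x"
    and inv: "\<And>x. x \<in> V \<Longrightarrow> blinfun_apply T x \<in> V" "\<And>x. x \<in> V \<Longrightarrow> blinfun_apply (cadj T) x \<in> V"
  shows "T o\<^sub>L p = p o\<^sub>L T"
proof -
  have 1: "p o\<^sub>L (T o\<^sub>L p) = T o\<^sub>L p" and 2: "p o\<^sub>L (cadj T o\<^sub>L p) = cadj T o\<^sub>L p"
    by (rule blinfun_eqI, simp add: V inv)+
  have "cadj (p o\<^sub>L (cadj T o\<^sub>L p)) = cadj (cadj T o\<^sub>L p)"
    using 2 by simp
  then have "p o\<^sub>L (T o\<^sub>L p) = p o\<^sub>L T"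
    using p T cadj_bounded[OF T]
    by (simp add: cadj_compose bounded_ops_closure cadj_cadj is_projection_def compose_assoc)
  then show ?thesis
    using 1 by simp
qed

lemma closed_csubspace_closure:
  assumes 0: "0 \<in> U" and add: "\<And>x y. x \<in> U \<Longrightarrow> y \<in> U \<Longrightarrow> x + y \<in> U"
    and sc: "\<And>c x. x \<in> U \<Longrightarrow> c *\<^sub>C x \<in> (U::'h::complex_hilbert set)"
  shows "closed_csubspace (closure U)"
  unfolding closed_csubspace_def
proof (intro conjI ballI allI)
  show "0 \<in> closure U"
    using 0 closure_subset by blast
  show "x + y \<in> closure U" if xy: "x \<in> closure U" "y \<in> closure U" for x y
  proof -
    obtain f where f: "\<And>n. f n \<in> U" "f \<longlonglongrightarrow> x"
      using xy(1) unfolding closure_sequential by blast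
    obtain g where g: "\<And>n. g n \<in> U" "g \<longlonglongrightarrow> y"
      using xy(2) unfolding closure_sequential by blast
    from f g have "(\<lambda>n. f n + g n) \<longlonglongrightarrow> x + y" "\<And>n. f n + g n \<in> U"
      using add tendsto_add by blast+
    then show ?thesis
      unfolding closure_sequential by (intro exI[of _ "\<lambda>n. f n + g n"]) simp
  qed
  show "c *\<^sub>C x \<in> closure U" if x: "x \<in> closure U" for c x
  proof -
    obtain f where f: "\<And>n. f n \<in> U" "f \<longlonglongrightarrow> x"
      using x unfolding closure_sequential by blast
    then have "(\<lambda>n. c *\<^sub>C f n) \<longlonglongrightarrow> c *\<^sub>C x" "\<And>n. c *\<^sub>C f n \<in> U"
      using sc bounded_linear.tendsto[OF bounded_linear_scaleC] by blast+
    then show ?thesis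
      unfolding closure_sequential by (intro exI[of _ "\<lambda>n. c *\<^sub>C f n"]) simp
  qed
qed simp

text \<open>The projection onto the closure of the union of the ranges of a chain of projections is the
  strong limit of the chain, hence its supremum even among all operators.\<close>

lemma projection_chain_sup:
  fixes C :: "'h::complex_hilbert operator set"
  assumes C: "\<And>c. c \<in> C \<Longrightarrow> is_projection c" and ne: "C \<noteq> {}"
    and chain: "\<And>a b. a \<in> C \<Longrightarrow> b \<in> C \<Longrightarrow> op_le a b \<or> op_le b a"
  shows "\<exists>s. is_projection s \<and> (\<forall>c\<in>C. op_le c s) \<and> (\<forall>y. (\<forall>c\<in>C. op_le c y) \<longrightarrow> op_le s y) \<and>
    (\<forall>T\<in>bounded_ops. (\<forall>c\<in>C. T o\<^sub>L c = c o\<^sub>L T \<and> cadj T o\<^sub>L c = c o\<^sub>L cadj T) \<longrightarrow> T o\<^sub>L s = s o\<^sub>L T)"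
proof -
  define U where "U = {x. \<exists>c\<in>C. blinfun_apply c x = x}"
  have up: "blinfun_apply b x = x" if "a \<in> C" "b \<in> C" "op_le a b" "blinfun_apply a x = x" for a b x
    using projection_le_commute(1)[OF C C that(3)] that(1,2,4) by (metis blinfun_apply_blinfun_compose)
  have V: "closed_csubspace (closure U)"
  proof (rule closed_csubspace_closure)
    show "0 \<in> U"
      using ne by (auto simp: U_def)
    show "c *\<^sub>C x \<in> U" if "x \<in> U" for c x
      using that C[THEN is_projection_apply(1), THEN bounded_opsD] unfolding U_def by force
    fix x y assume "x \<in> U" "y \<in> U"
    then obtain a b where ab: "a \<in> C" "blinfun_apply a x = x" "b \<in> C" "blinfun_apply b y = y"
      by (auto simp: U_def)
    then have "\<exists>c\<in>C. blinfun_apply c x = x \<and> blinfun_apply c y = y"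
      using chain[of a b] up by blast
    then show "x + y \<in> U"
      unfolding U_def mem_Collect_eq by (metis blinfun.add_right)
  qed
  obtain s where s: "is_projection s" "\<And>x. blinfun_apply s x \<in> closure U"
    "\<And>x. x \<in> closure U \<Longrightarrow> blinfun_apply s x = x"
    using projection_onto_exists[OF V] by blast
  have le: "op_le c s" if c: "c \<in> C" for c
  proof -
    have "blinfun_apply c x \<in> U" for x
      using c C is_projection_apply(2) by (auto simp: U_def)
    then have "blinfun_apply c x \<in> closure U" for x
      using closure_subset by blast
    then have "s o\<^sub>L c = c"
      by (intro blinfun_eqI) (simp add: s(3))
    then show ?thesis
      using projection_le_iff[OF s(1) C[OF c]] by simp
  qed
  have least: "op_le s y" if y: "\<And>c. c \<in> C \<Longrightarrow> op_le c y" for y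
    unfolding op_le_def
  proof
    fix x
    obtain u where u: "\<And>n. u n \<in> U" and lim: "u \<longlonglongrightarrow> blinfun_apply s x"
      using s(2)[of x] unfolding closure_sequential by blast
    then obtain c where c: "\<And>n. c n \<in> C" "\<And>n. blinfun_apply (c n) (u n) = u n"
      unfolding U_def mem_Collect_eq by metis
    have cs: "blinfun_apply (c n) (blinfun_apply s x) = blinfun_apply (c n) x" for n
      using projection_le_commute(2)[OF s(1) C[OF c(1)] le[OF c(1)]] by (metis blinfun_apply_blinfun_compose)
    have "norm (blinfun_apply (c n) x - blinfun_apply s x) \<le> 2 * norm (u n - blinfun_apply s x)" for n
    proof -
      have "blinfun_apply (c n) x - blinfun_apply s x
          = - blinfun_apply (c n) (u n - blinfun_apply s x) + (u n - blinfun_apply s x)"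
        by (simp add: blinfun.diff_right c cs)
      also have "norm \<dots> \<le> norm (blinfun_apply (c n) (u n - blinfun_apply s x)) + norm (u n - blinfun_apply s x)"
        by (metis norm_minus_cancel norm_triangle_ineq)
      also have "\<dots> \<le> 2 * norm (u n - blinfun_apply s x)"
        using norm_projection_le[OF C[OF c(1)], of n "u n - blinfun_apply s x"] by simp
      finally show ?thesis .
    qed
    then have "\<forall>\<^sub>F n in sequentially. norm (blinfun_apply (c n) x - blinfun_apply s x)
        \<le> 2 * norm (u n - blinfun_apply s x)"
      by (rule eventuallyI)
    then have "(\<lambda>n. blinfun_apply (c n) x - blinfun_apply s x) \<longlonglongrightarrow> 0"
      by (rule Lim_null_comparison)
        (rule tendsto_mult_right_zero[OF tendsto_norm_zero[OF LIM_zero[OF lim]]])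
    then have "(\<lambda>n. blinfun_apply (c n) x) \<longlonglongrightarrow> blinfun_apply s x"
      by (simp only: LIM_zero_iff)
    then have lim_form: "(\<lambda>n. cinner (blinfun_apply y x - blinfun_apply (c n) x) x)
        \<longlonglongrightarrow> cinner (blinfun_apply y x - blinfun_apply s x) x"
      by (intro bounded_linear.tendsto[OF bounded_linear_cinner_left] tendsto_diff tendsto_const)
    have "cinner (blinfun_apply y x - blinfun_apply (c n) x) x \<in> \<real>\<^sub>\<ge>\<^sub>0" for n
      using y[OF c(1)] by (simp add: op_le_def blinfun.diff_left)
    from closed_sequentially[OF closed_nonneg_Reals_complex this lim_form]
    have "cinner (blinfun_apply y x - blinfun_apply s x) x \<in> \<real>\<^sub>\<ge>\<^sub>0" .
    then show "cinner (blinfun_apply (y - s) x) x \<in> \<real>\<^sub>\<ge>\<^sub>0"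
      by (simp add: blinfun.diff_left)
  qed
  have "T o\<^sub>L s = s o\<^sub>L T" if T: "T \<in> bounded_ops"
    and comm: "\<And>c. c \<in> C \<Longrightarrow> T o\<^sub>L c = c o\<^sub>L T" "\<And>c. c \<in> C \<Longrightarrow> cadj T o\<^sub>L c = c o\<^sub>L cadj T" for T
  proof -
    have inv: "blinfun_apply R x \<in> closure U" if R: "\<And>c. c \<in> C \<Longrightarrow> R o\<^sub>L c = c o\<^sub>L R" and x: "x \<in> closure U" for R x
    proof -
      obtain u where u: "\<And>n. u n \<in> U" "u \<longlonglongrightarrow> x"
        using x unfolding closure_sequential by auto
      have "blinfun_apply R (u n) \<in> U" for n
      proof -
        obtain c where c: "c \<in> C" "blinfun_apply c (u n) = u n"
          using u(1)[of n] by (auto simp: U_def)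
        have "blinfun_apply c (blinfun_apply R (u n)) = blinfun_apply R (u n)"
          using R[OF c(1)] c(2) by (metis blinfun_apply_blinfun_compose)
        then show ?thesis
          using c(1) by (auto simp: U_def)
      qed
      moreover have "(\<lambda>n. blinfun_apply R (u n)) \<longlonglongrightarrow> blinfun_apply R x"
        by (intro tendsto_intros u)
      ultimately show ?thesis
        unfolding closure_sequential by (intro exI[of _ "\<lambda>n. blinfun_apply R (u n)"]) simp
    qed
    show ?thesis
      by (rule projection_commutes[OF s(1) T, where V = "closure U"]) (use s inv comm in auto)
  qed
  then show ?thesis
    using s(1) le least by blast
qed

text \<open>Being equal to its bicommutant, a von Neumann algebra contains everything that commutes with its
  commutant. This is how
  projections onto kernels, sums and products, and suprema of chains are seen to stay in \<open>M\<close>.\<close>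

lemma vn_memI:
  assumes "von_neumann_algebra M" "T \<in> bounded_ops" "\<And>S. S \<in> commutant M \<Longrightarrow> T o\<^sub>L S = S o\<^sub>L T"
  shows "T \<in> M"
proof -
  have "T \<in> commutant (commutant M)"
    unfolding commutant_def[of "commutant M"] using assms by blast
  then show ?thesis
    using assms(1) by (simp add: von_neumann_algebra_def)
qed

lemma commutantD: "S \<in> commutant M \<Longrightarrow> S \<in> bounded_ops" "S \<in> commutant M \<Longrightarrow> T \<in> M \<Longrightarrow> S o\<^sub>L T = T o\<^sub>L S"
  by (auto simp: commutant_def)

lemma vn_bounded: "von_neumann_algebra M \<Longrightarrow> x \<in> M \<Longrightarrow> x \<in> bounded_ops"
  and vn_cadj: "von_neumann_algebra M \<Longrightarrow> x \<in> M \<Longrightarrow> cadj x \<in> M"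
  by (auto simp: von_neumann_algebra_def)

lemma vn_closure:
  assumes M: "von_neumann_algebra M" and x: "x \<in> M" and y: "y \<in> M"
  shows "x + y \<in> M" "x - y \<in> M" "x o\<^sub>L y \<in> M" "scaleC_op c x \<in> M"
proof -
  note b = vn_bounded[OF M x] vn_bounded[OF M y]
  have comm: "S o\<^sub>L x = x o\<^sub>L S" "S o\<^sub>L y = y o\<^sub>L S" if "S \<in> commutant M" for S
    using that x y commutantD by blast+
  show "x + y \<in> M" "x - y \<in> M"
    by (rule vn_memI[OF M], simp add: bounded_ops_closure b, simp add: compose_simps comm)+
  show "x o\<^sub>L y \<in> M"
    by (rule vn_memI[OF M], simp add: bounded_ops_closure b) (metis comm compose_assoc)
  show "scaleC_op c x \<in> M"
    by (rule vn_memI[OF M], simp add: bounded_ops_closure b)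
      (simp add: compose_simps comm compose_scaleC_right commutantD)
qed

lemma vn_zero_id:
  assumes M: "von_neumann_algebra M"
  shows "0 \<in> M" "id_blinfun \<in> M"
  by (rule vn_memI[OF M]; simp add: compose_simps)+

lemma vn_sum: "von_neumann_algebra M \<Longrightarrow> (\<And>i. i \<in> I \<Longrightarrow> f i \<in> M) \<Longrightarrow> sum f I \<in> M"
  by (induction I rule: infinite_finite_induct) (auto simp: vn_zero_id vn_closure)

lemma commutant_cadj:
  assumes M: "von_neumann_algebra M" and S: "S \<in> commutant M"
  shows "cadj S \<in> commutant M"
proof -
  have "cadj S o\<^sub>L X = X o\<^sub>L cadj S" if X: "X \<in> M" for X
  proof -
    have b: "X \<in> bounded_ops" "S \<in> bounded_ops" "cadj X \<in> bounded_ops"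
      using vn_bounded[OF M X] commutantD(1)[OF S] cadj_bounded by auto
    have "cadj (S o\<^sub>L cadj X) = cadj (cadj X o\<^sub>L S)"
      using commutantD(2)[OF S vn_cadj[OF M X]] by simp
    then show ?thesis
      using b by (simp add: cadj_compose cadj_cadj)
  qed
  then show ?thesis
    using cadj_bounded[OF commutantD(1)[OF S]] by (simp add: commutant_def)
qed

text \<open>The commutant of \<open>M\<close> is closed under adjoints, so its elements commute with the projection onto
  any closed subspace that they leave invariant.\<close>

lemma vn_projection_onto:
  assumes M: "von_neumann_algebra M" and V: "closed_csubspace V"
    and inv: "\<And>S x. S \<in> commutant M \<Longrightarrow> x \<in> V \<Longrightarrow> blinfun_apply S x \<in> V"
  shows "\<exists>p\<in>M. is_projection p \<and> (\<forall>x. blinfun_apply p x \<in> V) \<and> (\<forall>x\<in>V. blinfun_apply p x = x)"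
proof -
  obtain p where p: "is_projection p" "\<And>x. blinfun_apply p x \<in> V" "\<And>x. x \<in> V \<Longrightarrow> blinfun_apply p x = x"
    using projection_onto_exists[OF V] by blast
  have "p \<in> M"
  proof (rule vn_memI[OF M is_projection_apply(1)[OF p(1)]])
    fix S assume S: "S \<in> commutant M"
    show "p o\<^sub>L S = S o\<^sub>L p"
      by (rule projection_commutes[OF p(1) commutantD(1)[OF S], where V = V, symmetric])
        (use p inv S commutant_cadj[OF M S] in auto)
  qed
  then show ?thesis
    using p by blast
qed

section \<open>Minimal projections are abelian\<close>

text \<open>The properties of \<open>w\<close> are those of \<open>\<bar>y\<bar>\<close>. After scaling, \<open>1 - \<bar>y\<bar>\<close> is the limit of the iteration
  \<open>X \<mapsto> (b + X\<^sup>2) / 2\<close> with \<open>b = 1 - y\<^sup>2\<close>; the same iteration on real numbers with \<open>1\<close> in place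
  of \<open>b\<close> majorizes the norms of the increments, so it converges in norm.\<close>

lemma operator_abs_exists:
  fixes y :: "'h::complex_hilbert operator"
  assumes y: "y \<in> bounded_ops" and sa: "cadj y = y"
  shows "\<exists>w\<in>bounded_ops. op_le 0 w \<and> w o\<^sub>L w = y o\<^sub>L y \<and> (\<forall>T. T o\<^sub>L y = y o\<^sub>L T \<longrightarrow> T o\<^sub>L w = w o\<^sub>L T)"
proof -
  define r where "r = norm y + 1"
  have r: "r > 0"
    by (simp add: r_def add_nonneg_pos)
  define z where "z = (1 / r) *\<^sub>R y"
  have zb: "z \<in> bounded_ops"
    using y by (simp add: z_def scaleR_op bounded_ops_closure)
  have zs: "cinner (blinfun_apply z u) v = cinner u (blinfun_apply z v)" for u v
    using cinner_cadj[OF y, of u v] sa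
    by (simp add: z_def blinfun.scaleR_left scaleR_scaleC cinner_scaleC_left cinner_scaleC_right)
  have nz: "norm (blinfun_apply z u) \<le> norm u" for u
  proof -
    have "norm z \<le> 1"
      using r by (simp add: z_def r_def field_simps)
    then have "norm z * norm u \<le> 1 * norm u"
      by (intro mult_right_mono) auto
    then show ?thesis
      using norm_blinfun[of z u] by simp
  qed
  define b where "b = id_blinfun - (z o\<^sub>L z)"
  have bb: "b \<in> bounded_ops"
    using zb by (simp add: b_def bounded_ops_closure)
  have nb: "norm b \<le> 1"
  proof (rule norm_blinfun_bound)
    fix u
    have "(norm (blinfun_apply b u))\<^sup>2
        = (norm u)\<^sup>2 + (norm (blinfun_apply z (blinfun_apply z u)))\<^sup>2 - 2 * (norm (blinfun_apply z u))\<^sup>2"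
      using zs[of u "blinfun_apply z u"] cinner_self[of "blinfun_apply z u"]
      by (simp add: b_def blinfun.diff_left norm_sq_diff zs[symmetric])
    also have "\<dots> \<le> (norm u)\<^sup>2"
      using power_mono[OF nz[of "blinfun_apply z u"] norm_ge_zero, of 2]
        zero_le_power2[of "norm (blinfun_apply z u)"] by linarith
    finally show "norm (blinfun_apply b u) \<le> 1 * norm u"
      by (simp add: power2_le_iff_abs_le)
  qed simp
  \<comment> \<open>\<open>t\<close> is the majorizing sequence: \<open>\<parallel>Y n\<parallel> \<le> t n\<close> and the increments of \<open>Y\<close> are bounded by those of \<open>t\<close>.\<close>
  define Y where "Y n = ((\<lambda>X. (1/2) *\<^sub>R (b + (X o\<^sub>L X))) ^^ n) 0" for n
  define t :: "nat \<Rightarrow> real" where "t n = ((\<lambda>x. (1 + x\<^sup>2) / 2) ^^ n) 0" for n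
  have Y0: "Y 0 = 0" and YS: "Y (Suc n) = (1/2) *\<^sub>R (b + (Y n o\<^sub>L Y n))" for n
    by (simp_all add: Y_def)
  have t0: "t 0 = 0" and tS: "t (Suc n) = (1 + (t n)\<^sup>2) / 2" for n
    by (simp_all add: t_def)
  have t: "0 \<le> t n" "t n \<le> 1" for n
  proof (induction n)
    case (Suc n)
    have "(t n)\<^sup>2 \<le> 1"
      using Suc by (simp add: power_le_one)
    then show "0 \<le> t (Suc n)" "t (Suc n) \<le> 1"
      by (simp_all add: tS)
  qed (simp_all add: t0)
  have nY: "norm (Y n) \<le> t n" for n
  proof (induction n)
    case (Suc n)
    have "norm (Y n o\<^sub>L Y n) \<le> norm (Y n) * norm (Y n)"
      by (rule norm_blinfun_compose)
    also have "\<dots> \<le> t n * t n"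
      by (intro mult_mono Suc t) simp
    finally have "norm (b + (Y n o\<^sub>L Y n)) \<le> 1 + t n * t n"
      using nb norm_triangle_ineq[of b "Y n o\<^sub>L Y n"] by linarith
    then show ?case
      by (simp add: YS tS power2_eq_square)
  qed (simp add: Y0 t0)
  have step: "norm (Y (Suc n) - Y n) \<le> t (Suc n) - t n" for n
  proof (induction n)
    case 0
    then show ?case
      using nb by (simp add: YS Y0 tS t0)
  next
    case (Suc n)
    let ?D = "Y (Suc n) - Y n"
    have "Y (Suc (Suc n)) - Y (Suc n) = (1/2) *\<^sub>R ((Y (Suc n) o\<^sub>L ?D) + (?D o\<^sub>L Y n))"
    proof -
      have "(Y (Suc n) o\<^sub>L ?D) + (?D o\<^sub>L Y n) = (b + (Y (Suc n) o\<^sub>L Y (Suc n))) - (b + (Y n o\<^sub>L Y n))"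
        by (simp add: compose_simps)
      then show ?thesis
        by (simp only: YS scaleR_diff_right)
    qed
    then have "norm (Y (Suc (Suc n)) - Y (Suc n)) \<le> (1/2) * (norm (Y (Suc n) o\<^sub>L ?D) + norm (?D o\<^sub>L Y n))"
      by (simp add: norm_triangle_ineq)
    also have "\<dots> \<le> (1/2) * (t (Suc n) * (t (Suc n) - t n) + (t (Suc n) - t n) * t n)"
    proof -
      have "norm (Y (Suc n) o\<^sub>L ?D) \<le> t (Suc n) * (t (Suc n) - t n)"
        by (rule order_trans[OF norm_blinfun_compose mult_mono[OF nY Suc.IH t(1) norm_ge_zero]])
      moreover have "norm (?D o\<^sub>L Y n) \<le> (t (Suc n) - t n) * t n"
        by (rule order_trans[OF norm_blinfun_compose mult_mono[OF Suc.IH nY order_trans[OF norm_ge_zero Suc.IH] norm_ge_zero]])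
      ultimately show ?thesis
        by simp
    qed
    also have "\<dots> = t (Suc (Suc n)) - t (Suc n)"
      by (simp add: tS[of "Suc n"] power2_eq_square field_simps) (simp add: tS power2_eq_square field_simps)
    finally show ?case .
  qed
  have inc: "norm (Y m - Y n) \<le> t m - t n" if "n \<le> m" for m n
    using that
  proof (induction m rule: dec_induct)
    case (step m)
    have "norm (Y (Suc m) - Y n) \<le> norm (Y (Suc m) - Y m) + norm (Y m - Y n)"
      using norm_triangle_ineq[of "Y (Suc m) - Y m" "Y m - Y n"] by simp
    then show ?case
      using step.IH \<open>norm (Y (Suc m) - Y m) \<le> t (Suc m) - t m\<close> by simp
  qed simp
  have "incseq t"
    using order_trans[OF norm_ge_zero step] by (intro incseq_SucI) simp
  then have "convergent t"
    using incseq_convergent[of t 1] t(2) unfolding convergent_def by metis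
  then have "Cauchy t"
    by (rule convergent_Cauchy)
  have "Cauchy Y"
  proof (rule metric_CauchyI)
    fix e :: real assume "e > 0"
    then obtain N where N: "\<And>m n. N \<le> m \<Longrightarrow> N \<le> n \<Longrightarrow> dist (t m) (t n) < e"
      using metric_CauchyD[OF \<open>Cauchy t\<close>] by blast
    have "dist (Y m) (Y n) < e" if "N \<le> m" "N \<le> n" for m n
    proof (cases "n \<le> m")
      case True
      then show ?thesis
        using inc[OF True] N[OF that] by (simp add: dist_norm)
    next
      case False
      then show ?thesis
        using inc[of m n] N[OF that] by (simp add: dist_norm norm_minus_commute abs_minus_commute)
    qed
    then show "\<exists>N. \<forall>m\<ge>N. \<forall>n\<ge>N. dist (Y m) (Y n) < e"
      by blast
  qed
  then obtain L where L: "Y \<longlonglongrightarrow> L"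
    using Cauchy_convergent_iff convergent_def by blast
  have Lapp: "(\<lambda>n. blinfun_apply (Y n) u) \<longlonglongrightarrow> blinfun_apply L u" for u
    by (intro tendsto_intros L)
  have "(\<lambda>n. Y (Suc n)) \<longlonglongrightarrow> (1/2) *\<^sub>R (b + (L o\<^sub>L L))"
    unfolding YS by (intro tendsto_intros L bounded_bilinear.tendsto[OF bounded_bilinear_blinfun_compose])
  \<comment> \<open>The fixed point equation says \<open>(1 - L)\<^sup>2 = 1 - b = z\<^sup>2\<close>.\<close>
  then have fix_eq: "L = (1/2) *\<^sub>R (b + (L o\<^sub>L L))"
    using LIMSEQ_Suc[OF L] LIMSEQ_unique by blast
  have Yb: "Y n \<in> bounded_ops" for n
    by (induction n) (simp_all add: Y0 YS scaleR_op bounded_ops_closure bb)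
  have Lb: "L \<in> bounded_ops"
    unfolding bounded_ops_def
  proof (intro CollectI allI)
    fix c u
    have "(\<lambda>n. c *\<^sub>C blinfun_apply (Y n) u) \<longlonglongrightarrow> c *\<^sub>C blinfun_apply L u"
      by (rule bounded_linear.tendsto[OF bounded_linear_scaleC Lapp])
    then show "blinfun_apply L (c *\<^sub>C u) = c *\<^sub>C blinfun_apply L u"
      using Lapp[of "c *\<^sub>C u"] LIMSEQ_unique by (simp add: bounded_opsD[OF Yb])
  qed
  have Ys: "cinner (blinfun_apply (Y n) u) v = cinner u (blinfun_apply (Y n) v)" for n u v
    by (induction n arbitrary: u v)
      (simp_all add: Y0 YS b_def blinfun.bilinear_simps scaleR_scaleC cinner_simps zs)
  have Ls: "cinner (blinfun_apply L u) v = cinner u (blinfun_apply L v)" for u v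
    using bounded_linear.tendsto[OF bounded_linear_cinner_left Lapp[of u], of v]
      bounded_linear.tendsto[OF bounded_linear_cinner_right Lapp[of v], of u] LIMSEQ_unique
    by (simp add: Ys)
  have "norm (Y n) \<le> 1" for n
    using nY t(2) order_trans by blast
  then have nL: "norm L \<le> 1"
    using LIMSEQ_le_const2[OF tendsto_norm[OF L]] by blast
  define w where "w = r *\<^sub>R (id_blinfun - L)"
  have "(id_blinfun - L) o\<^sub>L (id_blinfun - L) = z o\<^sub>L z"
  proof -
    have "2 *\<^sub>R L = b + (L o\<^sub>L L)"
      by (subst fix_eq) simp
    then have "L + L = b + (L o\<^sub>L L)"
      by (simp add: scaleR_2)
    then show ?thesis
      by (simp add: compose_simps b_def algebra_simps)
  qed
  moreover have rr: "(r *\<^sub>R A) o\<^sub>L (r *\<^sub>R A) = (r * r) *\<^sub>R (A o\<^sub>L A)" for A :: "'h operator"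
    by (rule blinfun_eqI) (simp add: blinfun.bilinear_simps)
  moreover have "y = r *\<^sub>R z"
    using r by (simp add: z_def)
  ultimately have 1: "w o\<^sub>L w = y o\<^sub>L y"
    by (simp add: w_def)
  have 2: "op_le 0 w"
    unfolding op_le_def
  proof
    fix u
    have "Im (cinner (blinfun_apply L u) u) = 0"
      using Ls[of u u] cinner_commute[of u "blinfun_apply L u"] by (simp add: complex_eq_iff)
    moreover have "Re (cinner (blinfun_apply L u) u) \<le> (norm u)\<^sup>2"
    proof -
      have "norm (blinfun_apply L u) \<le> 1 * norm u"
        using norm_blinfun[of L u] mult_right_mono[OF nL, of "norm u"] by simp
      then have "norm (blinfun_apply L u) * norm u \<le> (norm u)\<^sup>2"
        by (simp add: power2_eq_square mult_right_mono)
      then show ?thesis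
        using Re_cinner_le[of "blinfun_apply L u" u] by simp
    qed
    ultimately show "cinner (blinfun_apply (w - 0) u) u \<in> \<real>\<^sub>\<ge>\<^sub>0"
      using r by (simp add: w_def blinfun.bilinear_simps scaleR_scaleC cinner_simps cinner_self
          complex_nonneg_Reals_iff del: of_real_power)
  qed
  have 3: "T o\<^sub>L w = w o\<^sub>L T" if T: "T o\<^sub>L y = y o\<^sub>L T" for T
  proof -
    have "T o\<^sub>L z = z o\<^sub>L T"
      using T by (simp add: z_def bounded_bilinear.scaleR_left[OF bounded_bilinear_blinfun_compose]
          bounded_bilinear.scaleR_right[OF bounded_bilinear_blinfun_compose])
    then have Tb: "T o\<^sub>L b = b o\<^sub>L T"
      by (simp add: b_def compose_simps) (metis compose_assoc)
    have TY: "T o\<^sub>L Y n = Y n o\<^sub>L T" for n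
    proof (induction n)
      case (Suc n)
      then have "T o\<^sub>L (Y n o\<^sub>L Y n) = (Y n o\<^sub>L Y n) o\<^sub>L T"
        by (metis compose_assoc)
      then show ?case
        by (simp add: YS bounded_bilinear.scaleR_left[OF bounded_bilinear_blinfun_compose]
          bounded_bilinear.scaleR_right[OF bounded_bilinear_blinfun_compose] compose_simps Tb)
    qed (simp add: Y0 compose_simps)
    have "(\<lambda>n. T o\<^sub>L Y n) \<longlonglongrightarrow> (T o\<^sub>L L)" "(\<lambda>n. Y n o\<^sub>L T) \<longlonglongrightarrow> (L o\<^sub>L T)"
      by (intro tendsto_intros L bounded_bilinear.tendsto[OF bounded_bilinear_blinfun_compose])+
    then have "T o\<^sub>L L = L o\<^sub>L T"
      using LIMSEQ_unique by (simp add: TY)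
    then show ?thesis
      by (simp add: w_def bounded_bilinear.scaleR_left[OF bounded_bilinear_blinfun_compose]
          bounded_bilinear.scaleR_right[OF bounded_bilinear_blinfun_compose] compose_simps)
  qed
  have "w \<in> bounded_ops"
    by (simp add: w_def scaleR_op bounded_ops_closure Lb)
  then show ?thesis
    using 1 2 3 by blast
qed

text \<open>Polarization in the direction of \<open>T x\<close>: the form at \<open>x + T x\<close> contains the cross term $2\|T x\|^2$.\<close>

lemma selfadjoint_zeroI:
  assumes T: "T \<in> bounded_ops" "cadj T = T" and 0: "\<And>x. Re (cinner (blinfun_apply T x) x) = 0"
  shows "T = 0"
proof -
  have "blinfun_apply T x = 0" for x
  proof -
    let ?y = "blinfun_apply T x"
    have "cinner (blinfun_apply T ?y) x = cinner ?y ?y"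
      using cinner_cadj[OF T(1), of ?y x] T(2) by simp
    then have "Re (cinner (blinfun_apply T (x + ?y)) (x + ?y)) = 2 * (norm ?y)\<^sup>2"
      using 0[of x] 0[of ?y] by (simp add: blinfun.add_right cinner_simps cinner_self del: of_real_power)
    then show ?thesis
      using 0[of "x + ?y"] by simp
  qed
  then show ?thesis
    by (intro blinfun_eqI) simp
qed

text \<open>The kernel of \<open>\<bar>y\<bar> + y\<close> inside the range of \<open>f\<close> is the range of a projection of \<open>M\<close> below \<open>f\<close>;
  if it is everything then \<open>y = - \<bar>y\<bar>\<close> there, and if it is zero then \<open>y = \<bar>y\<bar>\<close>
  because \<open>\<bar>y\<bar> + y\<close> annihilates the range of \<open>\<bar>y\<bar> - y\<close>.\<close>

lemma minimal_projection_definite: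
  assumes M: "von_neumann_algebra M" and f: "f \<in> M" "is_projection f"
    and min: "\<And>q. q \<in> M \<Longrightarrow> is_projection q \<Longrightarrow> op_le q f \<Longrightarrow> q = 0 \<or> q = f"
    and y: "y \<in> M" "cadj y = y" and comm: "f o\<^sub>L y = y o\<^sub>L f"
  shows "(\<forall>x. blinfun_apply f x = x \<longrightarrow> 0 \<le> Re (cinner (blinfun_apply y x) x)) \<or>
    (\<forall>x. blinfun_apply f x = x \<longrightarrow> Re (cinner (blinfun_apply y x) x) \<le> 0)"
proof -
  obtain w where w: "w \<in> bounded_ops" "op_le 0 w" "w o\<^sub>L w = y o\<^sub>L y"
    and wc: "\<And>T. T o\<^sub>L y = y o\<^sub>L T \<Longrightarrow> T o\<^sub>L w = w o\<^sub>L T"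
    using operator_abs_exists[OF vn_bounded[OF M y(1)] y(2)] by blast
  have wpos: "0 \<le> Re (cinner (blinfun_apply w x) x)" for x
    using w(2) by (auto simp: op_le_def complex_nonneg_Reals_iff)
  define V where "V = {x. blinfun_apply f x = x \<and> blinfun_apply (w + y) x = 0}"
  have "closed {x. blinfun_apply f x = x}" "closed {x. blinfun_apply (w + y) x = 0}"
    by (intro closed_Collect_eq continuous_intros)+
  then have "closed V"
    unfolding V_def Collect_conj_eq by (rule closed_Int)
  moreover have "w + y \<in> bounded_ops" "f \<in> bounded_ops"
    using w vn_bounded[OF M] y f by (auto intro: bounded_ops_closure)
  ultimately have V: "closed_csubspace V"
    unfolding closed_csubspace_def V_def
    by (auto simp: blinfun.add_right bounded_opsD simp del: plus_blinfun.rep_eq)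
  have inv: "blinfun_apply S x \<in> V" if S: "S \<in> commutant M" and x: "x \<in> V" for S x
  proof -
    have "S o\<^sub>L f = f o\<^sub>L S" "S o\<^sub>L (w + y) = (w + y) o\<^sub>L S"
      using commutantD(2)[OF S] f y wc by (simp_all add: compose_simps)
    then have "blinfun_apply f (blinfun_apply S x) = blinfun_apply S (blinfun_apply f x)"
      "blinfun_apply (w + y) (blinfun_apply S x) = blinfun_apply S (blinfun_apply (w + y) x)"
      by (metis blinfun_apply_blinfun_compose)+
    then show ?thesis
      using x by (simp add: V_def)
  qed
  obtain q where q: "q \<in> M" "is_projection q" "\<And>x. blinfun_apply q x \<in> V" "\<And>x. x \<in> V \<Longrightarrow> blinfun_apply q x = x"
    using vn_projection_onto[OF M V inv] by blast
  have "f o\<^sub>L q = q"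
    using q(3) by (intro blinfun_eqI) (simp add: V_def)
  then have "op_le q f"
    using projection_le_iff f q by blast
  then consider "q = 0" | "q = f"
    using min q by blast
  then show ?thesis
  proof cases
    case 1
    have "0 \<le> Re (cinner (blinfun_apply y x) x)" if x: "blinfun_apply f x = x" for x
    proof -
      have wf: "f o\<^sub>L w = w o\<^sub>L f" and wy: "y o\<^sub>L w = w o\<^sub>L y"
        using wc comm by auto
      let ?v = "blinfun_apply (w - y) x"
      have "f o\<^sub>L (w - y) = (w - y) o\<^sub>L f"
        using comm wf by (simp add: compose_simps)
      then have "blinfun_apply f ?v = ?v"
        using x by (metis blinfun_apply_blinfun_compose)
      moreover have "(w + y) o\<^sub>L (w - y) = 0"
        using wy w(3) by (simp add: compose_simps)
      then have "blinfun_apply (w + y) ?v = 0"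
        by (metis blinfun_apply_blinfun_compose zero_blinfun.rep_eq)
      ultimately have "?v \<in> V"
        by (simp add: V_def)
      then have "?v = 0"
        using q(4) 1 by force
      then show ?thesis
        using wpos[of x] by (simp add: blinfun.diff_left)
    qed
    then show ?thesis
      by blast
  next
    case 2
    have "Re (cinner (blinfun_apply y x) x) \<le> 0" if x: "blinfun_apply f x = x" for x
    proof -
      have "x \<in> V"
        using q(3)[of x] 2 x by simp
      then have "blinfun_apply y x = - blinfun_apply w x"
        by (simp add: V_def blinfun.add_left eq_neg_iff_add_eq_0 add.commute)
      then show ?thesis
        using wpos[of x] by (simp add: cinner_minus_left)
    qed
    then show ?thesis
      by blast
  qed
qed

text \<open>If the quadratic form of \<open>z\<close> took two different values on unit vectors in the range of a minimal
  projection, then subtracting a number between them would give an indefinite operator.\<close>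

lemma minimal_projection_selfadjoint_scalar:
  assumes M: "von_neumann_algebra M" and f: "f \<in> M" "is_projection f"
    and min: "\<And>q. q \<in> M \<Longrightarrow> is_projection q \<Longrightarrow> op_le q f \<Longrightarrow> q = 0 \<or> q = f"
    and z: "z \<in> M" "cadj z = z" "f o\<^sub>L z = z" "z o\<^sub>L f = z"
  shows "\<exists>c. z = scaleC_op c f"
proof (cases "f = 0")
  case True
  then show ?thesis
    using z by (intro exI[of _ 0]) (auto intro!: blinfun_eqI simp: compose_simps)
next
  case False
  then obtain u where "blinfun_apply f u \<noteq> 0"
    by (metis blinfun_eqI zero_blinfun.rep_eq)
  define a where "a = blinfun_apply f u"
  have a: "a \<noteq> 0" "blinfun_apply f a = a"
    using \<open>blinfun_apply f u \<noteq> 0\<close> is_projection_apply(2)[OF f(2)] by (auto simp: a_def)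
  define Q where "Q x = Re (cinner (blinfun_apply z x) x)" for x
  define c where "c = Q a / (norm a)\<^sup>2"
  note fb = is_projection_apply(1)[OF f(2)]
  have sa: "z - scaleC_op (complex_of_real e) f \<in> M"
    "cadj (z - scaleC_op (complex_of_real e) f) = z - scaleC_op (complex_of_real e) f" for e
    using vn_closure[OF M] z f fb vn_bounded[OF M z(1)]
    by (simp_all add: cadj_diff cadj_scaleC bounded_ops_closure is_projection_def)
  have form: "Re (cinner (blinfun_apply (z - scaleC_op (complex_of_real e) f) x) x) = Q x - e * (norm x)\<^sup>2"
    if "blinfun_apply f x = x" for e x
    using that by (simp add: Q_def blinfun.diff_left cinner_simps cinner_self flip: of_real_mult del: of_real_power)
  have Qc: "Q x = c * (norm x)\<^sup>2" if x: "blinfun_apply f x = x" for x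
  proof (rule ccontr)
    assume ne: "Q x \<noteq> c * (norm x)\<^sup>2"
    then have x0: "x \<noteq> 0"
      by (auto simp: Q_def)
    define d where "d = Q x / (norm x)\<^sup>2"
    have pos: "(norm x)\<^sup>2 > 0" "(norm a)\<^sup>2 > 0"
      using x0 a by auto
    define e where "e = (c + d) / 2"
    have "f o\<^sub>L (z - scaleC_op (complex_of_real e) f) = (z - scaleC_op (complex_of_real e) f) o\<^sub>L f"
      using z by (simp add: compose_simps compose_scaleC_right fb)
    from minimal_projection_definite[OF M f min sa this]
    have "(0 \<le> Q x - e * (norm x)\<^sup>2 \<and> 0 \<le> Q a - e * (norm a)\<^sup>2) \<or>
      (Q x - e * (norm x)\<^sup>2 \<le> 0 \<and> Q a - e * (norm a)\<^sup>2 \<le> 0)"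
      using form[OF x, of e] form[OF a(2), of e] x a(2) by metis
    moreover have "Q x - e * (norm x)\<^sup>2 = (d - c) / 2 * (norm x)\<^sup>2" "Q a - e * (norm a)\<^sup>2 = - ((d - c) / 2) * (norm a)\<^sup>2"
      using pos by (simp_all add: d_def c_def e_def field_simps)
    moreover have "d \<noteq> c"
      using ne pos by (auto simp: d_def field_simps)
    ultimately show False
      using pos by (auto simp: zero_le_mult_iff mult_le_0_iff)
  qed
  have "z - scaleC_op (complex_of_real c) f = 0"
  proof (rule selfadjoint_zeroI)
    show "z - scaleC_op (complex_of_real c) f \<in> bounded_ops"
      using sa vn_bounded[OF M] by blast
    fix x
    let ?T = "z - scaleC_op (complex_of_real c) f"
    have fT: "f o\<^sub>L ?T = ?T" "?T o\<^sub>L f = ?T"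
      using z f by (simp_all add: compose_simps compose_scaleC_right fb) (simp_all add: is_projection_def)
    have "blinfun_apply ?T x = blinfun_apply f (blinfun_apply ?T (blinfun_apply f x))"
      using fT by (metis blinfun_apply_blinfun_compose)
    then have "cinner (blinfun_apply ?T x) x = cinner (blinfun_apply ?T (blinfun_apply f x)) (blinfun_apply f x)"
      using is_projection_apply(3)[OF f(2)] by simp
    then show "Re (cinner (blinfun_apply ?T x) x) = 0"
      using form[of "blinfun_apply f x" c] Qc[of "blinfun_apply f x"] is_projection_apply(2)[OF f(2)] by simp
  qed (rule sa)
  then show ?thesis
    by auto
qed

text \<open>The real and imaginary parts of \<open>f x f\<close> are scalar multiples of a minimal \<open>f\<close>, so the corner \<open>f M f\<close>
  consists of scalar multiples of \<open>f\<close>.\<close>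

theorem minimal_projection_abelian:
  assumes M: "von_neumann_algebra M" and f: "f \<in> M" "is_projection f"
    and min: "\<And>q. q \<in> M \<Longrightarrow> is_projection q \<Longrightarrow> op_le q f \<Longrightarrow> q = 0 \<or> q = f"
  shows "abelian_projection M f"
proof -
  have ff: "f o\<^sub>L f = f" "cadj f = f" and fb: "f \<in> bounded_ops"
    using f by (auto simp: is_projection_def)
  have sc: "\<exists>c. f o\<^sub>L x o\<^sub>L f = scaleC_op c f" if x: "x \<in> M" for x
  proof -
    define a where "a = f o\<^sub>L x o\<^sub>L f"
    have aM: "a \<in> M" and fa: "f o\<^sub>L a = a" "a o\<^sub>L f = a"
      using x f vn_closure[OF M] ff by (simp_all add: a_def compose_assoc) (metis compose_assoc ff(1))
    have ab: "a \<in> bounded_ops" "cadj a \<in> M" "cadj a \<in> bounded_ops"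
      using aM vn_bounded[OF M] vn_cadj[OF M] by auto
    have fa': "f o\<^sub>L cadj a = cadj a" "cadj a o\<^sub>L f = cadj a"
      using fa cadj_compose[OF fb ab(1)] cadj_compose[OF ab(1) fb] ff by simp_all
    define h where "h = scaleC_op (1/2) (a + cadj a)"
    define k where "k = scaleC_op (- \<i>/2) (a - cadj a)"
    have ahk: "a = h + scaleC_op \<i> k"
      by (rule blinfun_eqI)
        (simp add: h_def k_def blinfun.bilinear_simps scaleC_scaleC scaleC_add_right scaleC_diff_right flip: scaleC_add_left)
    have "cadj h = h"
      using ab by (simp add: h_def cadj_scaleC cadj_add cadj_cadj bounded_ops_closure add.commute)
    moreover have "cadj k = scaleC_op (\<i>/2) (cadj a - a)"
      using ab by (simp add: k_def cadj_scaleC cadj_diff cadj_cadj bounded_ops_closure)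
    then have "cadj k = k"
      by (simp only:) (auto intro!: blinfun_eqI 
          simp: k_def blinfun.bilinear_simps scaleC_diff_right scaleC_minus_left)
    moreover have "h \<in> M" "k \<in> M"
      using aM ab vn_closure[OF M] by (simp_all add: h_def k_def)
    moreover have "f o\<^sub>L h = h" "h o\<^sub>L f = h" "f o\<^sub>L k = k" "k o\<^sub>L f = k"
      by (simp_all add: h_def k_def compose_simps compose_scaleC_right fb fa fa')
    ultimately obtain c d where "h = scaleC_op c f" "k = scaleC_op d f"
      using minimal_projection_selfadjoint_scalar[OF M f min] by metis
    then have "a = scaleC_op (c + \<i> * d) f"
      unfolding ahk by (intro blinfun_eqI) (simp add: blinfun.bilinear_simps scaleC_add_left scaleC_scaleC)
    then show ?thesis
      by (auto simp: a_def)
  qed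
  have "(f o\<^sub>L x o\<^sub>L f) o\<^sub>L (f o\<^sub>L y o\<^sub>L f) = (f o\<^sub>L y o\<^sub>L f) o\<^sub>L (f o\<^sub>L x o\<^sub>L f)" if xy: "x \<in> M" "y \<in> M" for x y
  proof -
    obtain c d where "f o\<^sub>L x o\<^sub>L f = scaleC_op c f" "f o\<^sub>L y o\<^sub>L f = scaleC_op d f"
      using sc xy by metis
    then show ?thesis
      by (auto intro!: blinfun_eqI simp: bounded_opsD[OF fb] scaleC_scaleC mult.commute)
  qed
  then show ?thesis
    using f by (simp add: abelian_projection_def)
qed

section \<open>A Lyapunov theorem for chains of projections\<close>

text \<open>The order-theoretic content of a set \<open>P\<close> of projections without minimal elements, closed under
  differences of comparable elements and suprema of chains, carrying a functional \<open>\<Psi>\<close> that is additive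
  and continuous along chains. The relation \<open>le\<close> is the order of the ambient group of operators;
  its translation invariance yields complements and orthogonal sums inside \<open>P\<close> from differences alone.
  Continuity at a supremum is phrased by approximation, which is stable under finite sums of functionals.\<close>

locale continuous_projections =
  fixes P :: "'a::ab_group_add set" and le :: "'a \<Rightarrow> 'a \<Rightarrow> bool" and \<Psi> :: "'a \<Rightarrow> real"
  assumes le_refl: "p \<in> P \<Longrightarrow> le p p"
    and le_trans: "le p q \<Longrightarrow> le q r \<Longrightarrow> le p r"
    and le_antisym: "p \<in> P \<Longrightarrow> q \<in> P \<Longrightarrow> le p q \<Longrightarrow> le q p \<Longrightarrow> p = q"
    and le_add: "le x y \<Longrightarrow> le (x + z) (y + z)"
    and le_flip: "le x y \<Longrightarrow> le (z - y) (z - x)"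
    and zero_in: "0 \<in> P"
    and zero_le: "p \<in> P \<Longrightarrow> le 0 p"
    and diff_in: "p \<in> P \<Longrightarrow> q \<in> P \<Longrightarrow> le q p \<Longrightarrow> p - q \<in> P"
    and sup_exists: "C \<subseteq> P \<Longrightarrow> C \<noteq> {} \<Longrightarrow> (\<And>a b. a \<in> C \<Longrightarrow> b \<in> C \<Longrightarrow> le a b \<or> le b a) \<Longrightarrow>
        \<exists>s\<in>P. (\<forall>c\<in>C. le c s) \<and> (\<forall>y\<in>P. (\<forall>c\<in>C. le c y) \<longrightarrow> le s y) \<and> (\<forall>e>0. \<exists>c\<in>C. \<Psi> s < \<Psi> c + e)"
    and split: "p \<in> P \<Longrightarrow> p \<noteq> 0 \<Longrightarrow> \<exists>q\<in>P. le q p \<and> q \<noteq> 0 \<and> q \<noteq> p"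
    and \<Psi>_nonneg: "p \<in> P \<Longrightarrow> 0 \<le> \<Psi> p"
    and \<Psi>_diff: "p \<in> P \<Longrightarrow> q \<in> P \<Longrightarrow> le q p \<Longrightarrow> \<Psi> (p - q) = \<Psi> p - \<Psi> q"
begin

definition dominated :: "('a \<Rightarrow> real) \<Rightarrow> bool" where
  "dominated \<psi> \<longleftrightarrow> (\<forall>p\<in>P. 0 \<le> \<psi> p \<and> \<psi> p \<le> \<Psi> p) \<and> (\<forall>p\<in>P. \<forall>q\<in>P. le q p \<longrightarrow> \<psi> (p - q) = \<psi> p - \<psi> q)"

text \<open>A splitting \<open>p = q + (p - q)\<close> on which all functionals of \<open>S\<close> are divided in one common ratio, which is
  arbitrary. This is the inductive invariant: for \<open>S = {\<Psi>}\<close> it follows from the absence of minimal elements.\<close>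

definition proportionally_splittable :: "('a \<Rightarrow> real) set \<Rightarrow> bool" where
  "proportionally_splittable S \<longleftrightarrow>
     (\<forall>p\<in>P. p \<noteq> 0 \<longrightarrow> (\<exists>q\<in>P. le q p \<and> q \<noteq> 0 \<and> q \<noteq> p \<and> (\<exists>c. \<forall>\<psi>\<in>S. \<psi> q = c * \<psi> p)))"

definition proportional_flow :: "('a \<Rightarrow> real) set \<Rightarrow> 'a \<Rightarrow> (real \<Rightarrow> 'a) \<Rightarrow> bool" where
  "proportional_flow S p f \<longleftrightarrow> f 0 = 0 \<and> f 1 = p \<and> f ` {0..1} \<subseteq> P \<and>
     (\<forall>s t. 0 \<le> s \<longrightarrow> s \<le> t \<longrightarrow> t \<le> 1 \<longrightarrow> le (f s) (f t)) \<and>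
     (\<forall>\<psi>\<in>S. \<forall>t\<in>{0..1}. \<psi> (f t) = t * \<psi> p)"

lemma dominated_\<Psi>: "dominated \<Psi>"
  by (simp add: dominated_def \<Psi>_nonneg \<Psi>_diff)

lemma dominated_diff: "dominated \<psi> \<Longrightarrow> p \<in> P \<Longrightarrow> q \<in> P \<Longrightarrow> le q p \<Longrightarrow> \<psi> (p - q) = \<psi> p - \<psi> q"
  by (simp add: dominated_def)

lemma dominated_zero: "dominated \<psi> \<Longrightarrow> \<psi> 0 = 0"
  using dominated_diff[of \<psi> 0 0] le_refl zero_in by simp

lemma dominated_mono: "dominated \<psi> \<Longrightarrow> p \<in> P \<Longrightarrow> q \<in> P \<Longrightarrow> le q p \<Longrightarrow> \<psi> q \<le> \<psi> p"
  using dominated_diff[of \<psi> p q] diff_in[of p q] by (auto simp: dominated_def)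

lemma dominated_increment:
  "dominated \<psi> \<Longrightarrow> p \<in> P \<Longrightarrow> q \<in> P \<Longrightarrow> le q p \<Longrightarrow> \<psi> p - \<psi> q \<le> \<Psi> p - \<Psi> q"
  using dominated_diff[of \<psi> p q] diff_in[of p q] \<Psi>_diff[of p q] by (auto simp: dominated_def)

lemma diff_le: "p \<in> P \<Longrightarrow> q \<in> P \<Longrightarrow> le q p \<Longrightarrow> le (p - q) p"
  using le_flip[of 0 q p] zero_le by simp

lemma add_in:
  assumes "p \<in> P" "q \<in> P" "le p q" "r \<in> P" "le r (q - p)"
  shows "p + r \<in> P" "le p (p + r)" "le (p + r) q" "dominated \<psi> \<Longrightarrow> \<psi> (p + r) = \<psi> p + \<psi> r"
proof -
  have 1: "p + r = q - ((q - p) - r)"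
    by simp
  have 2: "(q - p) - r \<in> P"
    using assms diff_in by simp
  have 3: "le ((q - p) - r) q"
    using assms diff_le diff_in le_trans by metis
  show pr: "p + r \<in> P"
    using diff_in[OF assms(2) 2 3] unfolding 1[symmetric] .
  show le: "le p (p + r)"
    using le_add[OF zero_le[OF assms(4)], of p] by (simp add: add.commute)
  show "le (p + r) q"
    using le_add[OF assms(5), of p] by (simp add: add.commute)
  show "\<psi> (p + r) = \<psi> p + \<psi> r" if "dominated \<psi>"
    using dominated_diff[OF that pr assms(1) le] by simp
qed

text \<open>Infima below \<open>p\<close> are complements in \<open>p\<close> of suprema.\<close>

lemma inf_exists:
  assumes p: "p \<in> P" and C: "C \<subseteq> P" "C \<noteq> {}" "\<And>a b. a \<in> C \<Longrightarrow> b \<in> C \<Longrightarrow> le a b \<or> le b a"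
    and le: "\<And>c. c \<in> C \<Longrightarrow> le c p"
  shows "\<exists>s\<in>P. (\<forall>c\<in>C. le s c) \<and> (\<forall>y\<in>P. le y p \<longrightarrow> (\<forall>c\<in>C. le y c) \<longrightarrow> le y s) \<and> le s p \<and>
    (\<forall>e>0. \<exists>c\<in>C. \<Psi> c - e < \<Psi> s)"
proof -
  have "\<exists>s\<in>P. (\<forall>c\<in>(\<lambda>c. p - c) ` C. le c s) \<and> (\<forall>y\<in>P. (\<forall>c\<in>(\<lambda>c. p - c) ` C. le c y) \<longrightarrow> le s y) \<and>
      (\<forall>e>0. \<exists>c\<in>(\<lambda>c. p - c) ` C. \<Psi> s < \<Psi> c + e)"
  proof (rule sup_exists)
    show "(\<lambda>c. p - c) ` C \<subseteq> P"
      using C le p diff_in by blast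
    fix a b assume "a \<in> (\<lambda>c. p - c) ` C" "b \<in> (\<lambda>c. p - c) ` C"
    then show "le a b \<or> le b a"
      using C(3) le_flip by blast
  qed (use C in auto)
  then obtain s where s: "s \<in> P" "\<And>c. c \<in> C \<Longrightarrow> le (p - c) s"
    "\<And>y. y \<in> P \<Longrightarrow> (\<And>c. c \<in> C \<Longrightarrow> le (p - c) y) \<Longrightarrow> le s y"
    "\<And>e. e > 0 \<Longrightarrow> \<exists>c\<in>C. \<Psi> s < \<Psi> (p - c) + e"
    by auto
  have sp: "le s p"
    using s(3)[OF p] C le p diff_le by blast
  show ?thesis
  proof (rule bexI[of _ "p - s"], intro conjI ballI impI allI)
    show "p - s \<in> P"
      using diff_in p s sp by blast
    show "le (p - s) c" if "c \<in> C" for c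
      using le_flip[OF s(2)[OF that], of p] by simp
    show "le y (p - s)" if "y \<in> P" "le y p" "\<forall>c\<in>C. le y c" for y
    proof -
      have "le s (p - y)"
        by (rule s(3)) (use that p diff_in le_flip in auto)
      then show ?thesis
        using le_flip[of s "p - y" p] by simp
    qed
    show "le (p - s) p"
      using diff_le p s sp by blast
    show "\<exists>c\<in>C. \<Psi> c - e < \<Psi> (p - s)" if e: "e > 0" for e
    proof -
      obtain c where c: "c \<in> C" "\<Psi> s < \<Psi> (p - c) + e"
        using s(4)[OF e] by blast
      then have "\<Psi> s < \<Psi> p - \<Psi> c + e"
        using \<Psi>_diff[OF p, of c] C le by auto
      then show ?thesis
        using c \<Psi>_diff[OF p s(1) sp] by force
    qed
  qed
qed

text \<open>Among the \<open>q\<close> below \<open>p\<close> whose values under \<open>S\<close> are proportional to those of \<open>p\<close>, take a maximal chain.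
  By maximality it contains the suprema and infima of its parts, and the values of \<open>\<Psi>\<close> on it have no gap:
  at a gap between \<open>l\<close> and \<open>u\<close>, a proportional part \<open>r\<close> of \<open>u - l\<close> would give a further element \<open>l + r\<close> of the chain.
  Hence the chain can be parametrized by \<open>\<Psi>\<close>.\<close>

lemma flow_of_splittable:
  assumes S: "\<And>\<psi>. \<psi> \<in> S \<Longrightarrow> dominated \<psi>" and \<Psi>S: "\<Psi> \<in> S"
    and split: "proportionally_splittable S" and p: "p \<in> P"
  shows "\<exists>f. proportional_flow S p f"
proof (cases "\<Psi> p = 0")
  case True
  then have 0: "\<psi> p = 0" if "\<psi> \<in> S" for \<psi>
    using S[OF that] p by (auto simp: dominated_def dest: bspec[of P])
  have "proportional_flow S p (\<lambda>t. if t = 1 then p else 0)"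
    unfolding proportional_flow_def
    using p zero_in zero_le le_refl by (auto simp: 0 dominated_zero[OF S])
  then show ?thesis
    by blast
next
  case False
  then have pos: "\<Psi> p > 0"
    using \<Psi>_nonneg[OF p] by simp
  \<comment> \<open>Proportionality cleared of denominators; the ratio is \<open>\<Psi> q / \<Psi> p\<close> because \<open>\<Psi> \<in> S\<close>.\<close>
  define Q where "Q = {q\<in>P. le q p \<and> (\<forall>\<psi>\<in>S. \<psi> q * \<Psi> p = \<Psi> q * \<psi> p)}"
  define K where "K = {C. C \<subseteq> Q \<and> (\<forall>a\<in>C. \<forall>b\<in>C. le a b \<or> le b a)}"
  have "\<exists>C\<in>K. \<forall>X\<in>K. C \<subseteq> X \<longrightarrow> X = C"
  proof (rule subset_Zorn')
    fix D assume D: "subset.chain K D"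
    show "\<Union> D \<in> K"
      unfolding K_def
    proof (intro CollectI conjI ballI)
      show "\<Union> D \<subseteq> Q"
        using D by (auto simp: subset_chain_def K_def)
      fix a b assume "a \<in> \<Union> D" "b \<in> \<Union> D"
      then obtain X Y where XY: "a \<in> X" "X \<in> D" "b \<in> Y" "Y \<in> D"
        by blast
      then have "X \<subseteq> Y \<or> Y \<subseteq> X"
        using D by (auto simp: subset_chain_def)
      then obtain Z where "a \<in> Z" "b \<in> Z" "Z \<in> D"
        using XY by blast
      then show "le a b \<or> le b a"
        using D by (auto simp: subset_chain_def K_def)
    qed
  qed
  then obtain C where CK: "C \<in> K" and max: "\<And>X. X \<in> K \<Longrightarrow> C \<subseteq> X \<Longrightarrow> X = C"
    by blast
  have CQ: "C \<subseteq> Q" and lin: "\<And>a b. a \<in> C \<Longrightarrow> b \<in> C \<Longrightarrow> le a b \<or> le b a"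
    using CK by (auto simp: K_def)
  have CP: "C \<subseteq> P" and Cp: "\<And>c. c \<in> C \<Longrightarrow> le c p"
    and ratio: "\<And>c \<psi>. c \<in> C \<Longrightarrow> \<psi> \<in> S \<Longrightarrow> \<psi> c * \<Psi> p = \<Psi> c * \<psi> p"
    using CQ by (auto simp: Q_def)
  have maxI: "q \<in> C" if "q \<in> Q" "\<And>c. c \<in> C \<Longrightarrow> le c q \<or> le q c" for q
  proof -
    have "insert q C \<in> K"
      using that CQ lin le_refl by (auto simp: K_def Q_def)
    then show ?thesis
      using max[of "insert q C"] by blast
  qed
  have 0: "0 \<in> C"
    by (rule maxI) (use p zero_in zero_le CP in \<open>auto simp: Q_def dominated_zero[OF S] dominated_zero[OF dominated_\<Psi>]\<close>)
  have 1: "p \<in> C"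
    by (rule maxI) (use p le_refl Cp in \<open>auto simp: Q_def\<close>)
  have mono: "le a b" if "a \<in> C" "b \<in> C" "\<Psi> a < \<Psi> b" for a b
    using lin[OF that(1,2)] that CP dominated_mono[OF dominated_\<Psi>, of a b] 
    by (metis dominated_\<Psi> dominated_mono not_less subsetD)
  \<comment> \<open>Increments of \<open>\<psi>\<close> are bounded by those of \<open>\<Psi>\<close>, so proportionality passes to limits along the chain.\<close>
  have limit: "q \<in> Q" if q: "q \<in> P" "le q p" 
      and lim: "\<And>e. e > 0 \<Longrightarrow> \<exists>c\<in>C. (le c q \<or> le q c) \<and> \<bar>\<Psi> q - \<Psi> c\<bar> < e" for q
  proof -
    have "\<psi> q * \<Psi> p = \<Psi> q * \<psi> p" if \<psi>: "\<psi> \<in> S" for \<psi>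
    proof (rule ccontr)
      let ?D = "\<bar>\<psi> q * \<Psi> p - \<Psi> q * \<psi> p\<bar>"
      assume "\<psi> q * \<Psi> p \<noteq> \<Psi> q * \<psi> p"
      then have "?D / (2 * \<Psi> p) > 0"
        using pos by simp
      from lim[OF this] obtain c where c: "c \<in> C" "le c q \<or> le q c" and e: "\<bar>\<Psi> q - \<Psi> c\<bar> < ?D / (2 * \<Psi> p)"
        by blast
      have cP: "c \<in> P"
        using c CP by blast
      have 1: "\<bar>\<psi> q - \<psi> c\<bar> \<le> \<bar>\<Psi> q - \<Psi> c\<bar>"
        using c(2) dominated_increment[OF S[OF \<psi>], of q c] dominated_increment[OF S[OF \<psi>], of c q]
          dominated_mono[OF S[OF \<psi>], of q c] dominated_mono[OF S[OF \<psi>], of c q] q(1) cP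
        by (auto simp: abs_if)
      have \<psi>p: "\<bar>\<psi> p\<bar> \<le> \<Psi> p"
        using S[OF \<psi>] p by (auto simp: dominated_def)
      have "\<psi> q * \<Psi> p - \<Psi> q * \<psi> p = (\<psi> q - \<psi> c) * \<Psi> p - (\<Psi> q - \<Psi> c) * \<psi> p"
        using ratio[OF c(1) \<psi>] by (simp add: algebra_simps)
      then have "?D \<le> \<bar>(\<psi> q - \<psi> c) * \<Psi> p\<bar> + \<bar>(\<Psi> q - \<Psi> c) * \<psi> p\<bar>"
        by (simp only: abs_triangle_ineq4)
      then have "?D \<le> \<bar>\<psi> q - \<psi> c\<bar> * \<Psi> p + \<bar>\<Psi> q - \<Psi> c\<bar> * \<bar>\<psi> p\<bar>"
        using pos by (simp only: abs_mult abs_of_pos)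
      also have "\<dots> \<le> \<bar>\<Psi> q - \<Psi> c\<bar> * \<Psi> p + \<bar>\<Psi> q - \<Psi> c\<bar> * \<Psi> p"
        using 1 \<psi>p pos by (intro add_mono mult_mono) auto
      also have "\<dots> = \<bar>\<Psi> q - \<Psi> c\<bar> * (2 * \<Psi> p)"
        by simp
      also have "\<dots> < ?D"
        using e pos by (simp add: pos_less_divide_eq)
      finally show False
        by simp
    qed
    then show ?thesis
      using q by (simp add: Q_def)
  qed
  have hit: "\<exists>c\<in>C. \<Psi> c = t * \<Psi> p" if t: "0 \<le> t" "t \<le> 1" for t
  proof (rule ccontr)
    assume no: "\<not> (\<exists>c\<in>C. \<Psi> c = t * \<Psi> p)"
    define L where "L = {c\<in>C. \<Psi> c < t * \<Psi> p}"
    define U where "U = {c\<in>C. t * \<Psi> p < \<Psi> c}"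
    have LU: "c \<in> L \<or> c \<in> U" if "c \<in> C" for c
      using that no unfolding L_def U_def by force
    have ord: "le a b" if "a \<in> L" "b \<in> U" for a b
      using that mono by (auto simp: L_def U_def)
    have "0 \<in> L"
    proof -
      have "\<Psi> 0 \<noteq> t * \<Psi> p"
        using no 0 by blast
      then show ?thesis
        using 0 t pos dominated_zero[OF dominated_\<Psi>] by (simp add: L_def order_less_le)
    qed
    have "p \<in> U"
    proof -
      have "t * \<Psi> p \<le> \<Psi> p"
        using t pos by simp
      then show ?thesis
        using 1 no by (auto simp: U_def order_less_le)
    qed
    have "\<exists>s\<in>P. (\<forall>c\<in>L. le c s) \<and> (\<forall>y\<in>P. (\<forall>c\<in>L. le c y) \<longrightarrow> le s y) \<and> (\<forall>e>0. \<exists>c\<in>L. \<Psi> s < \<Psi> c + e)"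
      by (rule sup_exists) (use CP lin \<open>0 \<in> L\<close> in \<open>auto simp: L_def\<close>)
    then obtain l where lP: "l \<in> P" and lub: "\<And>c. c \<in> L \<Longrightarrow> le c l"
      and lleast: "\<And>y. y \<in> P \<Longrightarrow> (\<And>c. c \<in> L \<Longrightarrow> le c y) \<Longrightarrow> le l y"
      and lapp: "\<And>e. e > 0 \<Longrightarrow> \<exists>c\<in>L. \<Psi> l < \<Psi> c + e"
      by blast
    have lU: "le l c" if "c \<in> U" for c
      using lleast[of c] ord that CP by (auto simp: U_def)
    have "l \<in> C"
    proof (rule maxI)
      show "l \<in> Q"
      proof (rule limit)
        show "le l p"
          using lU \<open>p \<in> U\<close> .
        fix e :: real assume "e > 0"
        then obtain c where c: "c \<in> L" "\<Psi> l < \<Psi> c + e"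
          using lapp by blast
        then have "\<Psi> c \<le> \<Psi> l"
          using dominated_mono[OF dominated_\<Psi> lP, of c] lub CP by (auto simp: L_def)
        then show "\<exists>c\<in>C. (le c l \<or> le l c) \<and> \<bar>\<Psi> l - \<Psi> c\<bar> < e"
          using c lub by (intro bexI[of _ c]) (auto simp: L_def)
      qed fact
    qed (use LU lU lub in blast)
    have "\<exists>s\<in>P. (\<forall>c\<in>U. le s c) \<and> (\<forall>y\<in>P. le y p \<longrightarrow> (\<forall>c\<in>U. le y c) \<longrightarrow> le y s) \<and> le s p \<and>
      (\<forall>e>0. \<exists>c\<in>U. \<Psi> c - e < \<Psi> s)"
      by (rule inf_exists) (use CP p Cp lin \<open>p \<in> U\<close> in \<open>auto simp: U_def\<close>)
    then obtain u where uP: "u \<in> P" and glb: "\<And>c. c \<in> U \<Longrightarrow> le u c"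
      and ugreatest: "\<And>y. y \<in> P \<Longrightarrow> le y p \<Longrightarrow> (\<And>c. c \<in> U \<Longrightarrow> le y c) \<Longrightarrow> le y u" and up: "le u p"
      and uapp: "\<And>e. e > 0 \<Longrightarrow> \<exists>c\<in>U. \<Psi> c - e < \<Psi> u"
      by blast
    have Lu: "le c u" if "c \<in> L" for c
      using ugreatest[of c] ord that CP Cp by (auto simp: L_def)
    have "u \<in> C"
    proof (rule maxI)
      show "u \<in> Q"
      proof (rule limit)
        fix e :: real assume "e > 0"
        then obtain c where c: "c \<in> U" "\<Psi> c - e < \<Psi> u"
          using uapp by blast
        then have "\<Psi> u \<le> \<Psi> c"
          using dominated_mono[OF dominated_\<Psi> _ uP, of c] glb CP by (auto simp: U_def)
        then show "\<exists>c\<in>C. (le c u \<or> le u c) \<and> \<bar>\<Psi> u - \<Psi> c\<bar> < e"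
          using c glb by (intro bexI[of _ c]) (auto simp: U_def)
      qed fact+
    qed (use LU Lu glb in blast)
    have lu: "le l u"
      using lleast[OF uP Lu] .
    have "l \<in> L"
    proof (rule ccontr)
      assume "l \<notin> L"
      then have lt: "t * \<Psi> p < \<Psi> l"
        using LU[OF \<open>l \<in> C\<close>] by (auto simp: U_def)
      then obtain c where "c \<in> L" "\<Psi> l < \<Psi> c + (\<Psi> l - t * \<Psi> p)"
        using lapp[of "\<Psi> l - t * \<Psi> p"] by auto
      then show False
        by (auto simp: L_def)
    qed
    have "u \<in> U"
    proof (rule ccontr)
      assume "u \<notin> U"
      then have lt: "\<Psi> u < t * \<Psi> p"
        using LU[OF \<open>u \<in> C\<close>] by (auto simp: L_def)
      then obtain c where "c \<in> U" "\<Psi> c - (t * \<Psi> p - \<Psi> u) < \<Psi> u"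
        using uapp[of "t * \<Psi> p - \<Psi> u"] by auto
      then show False
        by (auto simp: U_def)
    qed
    have "u - l \<in> P" "u - l \<noteq> 0"
      using diff_in[OF uP lP lu] \<open>l \<in> L\<close> \<open>u \<in> U\<close> by (auto simp: L_def U_def)
    then obtain r c where r: "r \<in> P" "le r (u - l)" "r \<noteq> 0" "r \<noteq> u - l"
      and rc: "\<And>\<psi>. \<psi> \<in> S \<Longrightarrow> \<psi> r = c * \<psi> (u - l)"
      using split unfolding proportionally_splittable_def by blast
    note lr = add_in[OF lP uP lu r(1,2)]
    have "l + r \<in> C"
    proof (rule maxI)
      have "\<psi> (l + r) * \<Psi> p = \<Psi> (l + r) * \<psi> p" if \<psi>: "\<psi> \<in> S" for \<psi>
      proof -
        have e: "\<psi>' (l + r) = (1 - c) * \<psi>' l + c * \<psi>' u" if "\<psi>' \<in> S" for \<psi>'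
          using lr(4)[OF S[OF that]] rc[OF that] dominated_diff[OF S[OF that] uP lP lu]
          by (simp add: algebra_simps)
        have "\<psi> (l + r) * \<Psi> p = (1 - c) * (\<psi> l * \<Psi> p) + c * (\<psi> u * \<Psi> p)"
          by (simp add: e[OF \<psi>] algebra_simps)
        also have "\<dots> = \<Psi> (l + r) * \<psi> p"
          using ratio[OF \<open>l \<in> C\<close> \<psi>] ratio[OF \<open>u \<in> C\<close> \<psi>] by (simp add: e[OF \<Psi>S] algebra_simps)
        finally show ?thesis .
      qed
      then show "l + r \<in> Q"
        using lr(1) le_trans[OF lr(3) up] by (simp add: Q_def)
      show "le c (l + r) \<or> le (l + r) c" if "c \<in> C" for c
        using LU[OF that] le_trans[OF lub lr(2)] le_trans[OF lr(3) glb] by blast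
    qed
    then consider "l + r \<in> L" | "l + r \<in> U"
      using LU by blast
    then show False
    proof cases
      case 1
      then have "l + r = l"
        using le_antisym[OF lr(1) lP lub[OF 1] lr(2)] by simp
      then show False
        using r by simp
    next
      case 2
      then have "l + r = u"
        using le_antisym[OF lr(1) uP lr(3) glb[OF 2]] by simp
      then show False
        using r by auto
    qed
  qed
  then obtain g where g: "\<And>t. 0 \<le> t \<Longrightarrow> t \<le> 1 \<Longrightarrow> g t \<in> C \<and> \<Psi> (g t) = t * \<Psi> p"
    by metis
  define f where "f t = (if t = 0 then 0 else if t = 1 then p else g t)" for t :: real
  have f: "f t \<in> C" "\<Psi> (f t) = t * \<Psi> p" if "0 \<le> t" "t \<le> 1" for t
    using that g 0 1 dominated_zero[OF dominated_\<Psi>] by (auto simp: f_def)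
  have "le (f s) (f t)" if "0 \<le> s" "s \<le> t" "t \<le> 1" for s t
  proof (cases "s = t")
    case True
    then show ?thesis
      using le_refl f CP that by auto
  next
    case False
    then show ?thesis
      using that pos f[of s] f[of t] by (intro mono) auto
  qed
  moreover have "\<psi> (f t) = t * \<psi> p" if "\<psi> \<in> S" "0 \<le> t" "t \<le> 1" for \<psi> t
    using ratio[OF f(1)[OF that(2,3)] that(1)] pos f(2)[OF that(2,3)] by (simp add: field_simps)
  moreover have "f ` {0..1} \<subseteq> P" "f 0 = 0" "f 1 = p"
    using f(1) CP by (auto simp: f_def[of 0] f_def[of 1])
  ultimately have "proportional_flow S p f"
    unfolding proportional_flow_def by auto
  then show ?thesis
    by blast
qed

text \<open>The value of \<open>\<psi>\<close> on the piece of the flow between \<open>t\<close> and \<open>t + 1/2\<close> is continuous in \<open>t\<close>, being Lipschitz by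
  domination, and its values at \<open>t = 0\<close> and \<open>t = 1/2\<close> add up to \<open>\<psi> p\<close>. So it is \<open>\<psi> p / 2\<close> somewhere in between,
  while each functional of \<open>S\<close> takes half its value on all of these pieces.\<close>

lemma halving_of_flow:
  assumes S: "\<And>\<psi>. \<psi> \<in> S \<Longrightarrow> dominated \<psi>" and \<Psi>S: "\<Psi> \<in> S" and \<psi>: "dominated \<psi>"
    and p: "p \<in> P" and f: "proportional_flow S p f"
  shows "\<exists>q\<in>P. le q p \<and> (\<forall>\<mu>\<in>insert \<psi> S. \<mu> q = \<mu> p / 2)"
proof -
  have fP: "\<And>t. 0 \<le> t \<Longrightarrow> t \<le> 1 \<Longrightarrow> f t \<in> P" 
    and mono: "\<And>s t. 0 \<le> s \<Longrightarrow> s \<le> t \<Longrightarrow> t \<le> 1 \<Longrightarrow> le (f s) (f t)"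
    and lin: "\<And>\<mu> t. \<mu> \<in> S \<Longrightarrow> 0 \<le> t \<Longrightarrow> t \<le> 1 \<Longrightarrow> \<mu> (f t) = t * \<mu> p" and f01: "f 0 = 0" "f 1 = p"
    using f by (auto simp: proportional_flow_def)
  have diff: "\<mu> (f (t + 1/2) - f t) = \<mu> (f (t + 1/2)) - \<mu> (f t)" if "dominated \<mu>" "0 \<le> t" "t \<le> 1/2" for \<mu> t
    using that fP mono by (intro dominated_diff) auto
  have lip: "\<bar>\<psi> (f t) - \<psi> (f s)\<bar> \<le> \<Psi> p * \<bar>t - s\<bar>" if "s \<in> {0..1}" "t \<in> {0..1}" for s t
    using that
  proof (induction s t rule: linorder_wlog)
    case (le s t)
    then have "\<psi> (f t) - \<psi> (f s) \<le> \<Psi> (f t) - \<Psi> (f s)" "0 \<le> \<psi> (f t) - \<psi> (f s)"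
      using dominated_increment[OF \<psi>] dominated_mono[OF \<psi>] fP mono by auto
    then show ?case
      using le lin[OF \<Psi>S] by (simp add: algebra_simps)
  next
    case (sym s t)
    then show ?case
      by (simp add: abs_minus_commute)
  qed
  have cont: "continuous_on {0..1} (\<lambda>t. \<psi> (f t))"
  proof (rule lipschitz_on_continuous_on)
    show "(\<Psi> p)-lipschitz_on {0..1} (\<lambda>t. \<psi> (f t))"
      by (rule lipschitz_onI) (use lip \<Psi>_nonneg[OF p] in \<open>auto simp: dist_real_def abs_minus_commute\<close>)
  qed
  define G where "G t = \<psi> (f (t + 1/2)) - \<psi> (f t)" for t
  have "continuous_on {0..1/2} G"
    unfolding G_def
    by (intro continuous_intros continuous_on_compose2[OF cont] continuous_on_subset[OF cont]) auto
  moreover have "G 0 + G (1/2) = \<psi> p"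
    using f01 dominated_zero[OF \<psi>] by (simp add: G_def)
  ultimately have "\<exists>t. 0 \<le> t \<and> t \<le> 1/2 \<and> G t = \<psi> p / 2"
  proof (cases "G 0 \<le> \<psi> p / 2")
    case True
    then show ?thesis
      using IVT'[of G 0 "\<psi> p / 2" "1/2"] \<open>continuous_on {0..1/2} G\<close> \<open>G 0 + G (1/2) = \<psi> p\<close> by auto
  next
    case False
    then show ?thesis
      using IVT2'[of G "1/2" "\<psi> p / 2" 0] \<open>continuous_on {0..1/2} G\<close> \<open>G 0 + G (1/2) = \<psi> p\<close> by auto
  qed
  then obtain t where t: "0 \<le> t" "t \<le> 1/2" "G t = \<psi> p / 2"
    by blast
  have q: "f (t + 1/2) - f t \<in> P" "le (f (t + 1/2) - f t) p"
    using t fP mono diff_in diff_le[of "f (t + 1/2)" "f t"] le_trans[OF _ mono[of "t + 1/2" 1]] f01 by auto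
  show ?thesis
  proof (intro bexI[of _ "f (t + 1/2) - f t"] conjI ballI q)
    fix \<mu> assume "\<mu> \<in> insert \<psi> S"
    then show "\<mu> (f (t + 1/2) - f t) = \<mu> p / 2"
      using t diff[OF \<psi>, of t] diff[OF S, of \<mu> t] lin[of \<mu> t] lin[of \<mu> "t + 1/2"]
      by (auto simp: G_def algebra_simps)
  qed
qed

text \<open>Induction on \<open>S\<close>: a flow for \<open>S\<close> halves one more functional, a halving is a proportional splitting, and a
  proportional splitting property gives flows again. When \<open>\<Psi> p = 0\<close> all functionals vanish below \<open>p\<close> and any
  proper part of \<open>p\<close> serves as the splitting.\<close>

theorem proportional_flow_exists:
  assumes "finite S" "\<And>\<psi>. \<psi> \<in> S \<Longrightarrow> dominated \<psi>" "p \<in> P"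
  shows "\<exists>f. proportional_flow (insert \<Psi> S) p f"
proof -
  have "proportionally_splittable (insert \<Psi> S)"
    using assms(1,2)
  proof (induction S rule: finite_induct)
    case empty
    show ?case
      unfolding proportionally_splittable_def
    proof (intro ballI impI)
      fix p assume p: "p \<in> P" "p \<noteq> 0"
      then obtain q where q: "q \<in> P" "le q p" "q \<noteq> 0" "q \<noteq> p"
        using split by blast
      have "\<Psi> q = \<Psi> q / \<Psi> p * \<Psi> p"
        using dominated_mono[OF dominated_\<Psi> p(1) q(1,2)] \<Psi>_nonneg[OF q(1)] by auto
      then show "\<exists>q\<in>P. le q p \<and> q \<noteq> 0 \<and> q \<noteq> p \<and> (\<exists>c. \<forall>\<psi>\<in>{\<Psi>}. \<psi> q = c * \<psi> p)"
        using q by blast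
    qed
  next
    case (insert \<psi> S)
    have dom: "\<And>\<mu>. \<mu> \<in> insert \<Psi> S \<Longrightarrow> dominated \<mu>" and \<psi>: "dominated \<psi>"
      using insert.prems dominated_\<Psi> by auto
    show ?case
      unfolding proportionally_splittable_def
    proof (intro ballI impI)
      fix p assume p: "p \<in> P" "p \<noteq> 0"
      show "\<exists>q\<in>P. le q p \<and> q \<noteq> 0 \<and> q \<noteq> p \<and> (\<exists>c. \<forall>\<mu>\<in>insert \<Psi> (insert \<psi> S). \<mu> q = c * \<mu> p)"
      proof (cases "\<Psi> p = 0")
        case True
        then obtain q where q: "q \<in> P" "le q p" "q \<noteq> 0" "q \<noteq> p"
          using split p by blast
        have "\<mu> q = 0" if "\<mu> \<in> insert \<Psi> (insert \<psi> S)" for \<mu>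
        proof -
          have \<mu>: "dominated \<mu>"
            using that dom \<psi> by auto
          then have "0 \<le> \<mu> q" "\<mu> p \<le> 0"
            using True p q by (force simp: dominated_def)+
          then show ?thesis
            using dominated_mono[OF \<mu> p(1) q(1,2)] by simp
        qed
        then show ?thesis
          using q by (intro bexI[of _ q] conjI exI[of _ 0]) auto
      next
        case False
        obtain f where "proportional_flow (insert \<Psi> S) p f"
          using flow_of_splittable[OF dom insertI1 insert.IH p(1)] insert.prems by auto
        from halving_of_flow[OF dom insertI1 \<psi> p(1) this] obtain q 
          where q: "q \<in> P" "le q p" "\<And>\<mu>. \<mu> \<in> insert \<psi> (insert \<Psi> S) \<Longrightarrow> \<mu> q = \<mu> p / 2"
          by blast
        have "\<Psi> q = \<Psi> p / 2"
          using q(3) by blast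
        then have "q \<noteq> 0" "q \<noteq> p"
          using False dominated_zero[OF dominated_\<Psi>] by auto
        then show ?thesis
          using q by (intro bexI[of _ q] conjI exI[of _ "1/2"]) auto
      qed
    qed
  qed
  then show ?thesis
    using flow_of_splittable[of "insert \<Psi> S" p] assms dominated_\<Psi> by auto
qed

end

section \<open>Spanning and averaging in matrix algebras\<close>

definition matrix_scale :: "complex \<Rightarrow> complex ^ 'm ^ 'm \<Rightarrow> complex ^ 'm ^ 'm" where
  "matrix_scale c X = (\<chi> i j. c * X $ i $ j)"

definition matrix_star :: "complex ^ 'm ^ 'm \<Rightarrow> complex ^ 'm ^ 'm" where
  "matrix_star X = (\<chi> i j. cnj (X $ j $ i))"

definition matrix_unit :: "'m \<Rightarrow> 'm \<Rightarrow> complex ^ 'm ^ 'm" where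
  "matrix_unit a b = (\<chi> i j. if i = a \<and> j = b then 1 else 0)"

definition rank_one :: "('m \<Rightarrow> complex) \<Rightarrow> complex ^ 'm ^ 'm" where
  "rank_one v = (\<chi> i j. v i * cnj (v j))"

lemma sum_delta_mult:
  fixes c :: complex
  shows "(\<Sum>i\<in>UNIV. (if i = a then c else 0) * F i) = c * F (a :: 'm::finite)"
    "(\<Sum>i\<in>UNIV. F i * (if i = a then c else 0)) = F a * c"
proof -
  have "(\<Sum>i\<in>UNIV. (if i = a then c else 0) * F i) = (\<Sum>i\<in>UNIV. if i = a then c * F a else 0)"
    by (rule sum.cong) auto
  then show "(\<Sum>i\<in>UNIV. (if i = a then c else 0) * F i) = c * F a"
    by simp
  then show "(\<Sum>i\<in>UNIV. F i * (if i = a then c else 0)) = F a * c"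
    by (simp add: mult.commute)
qed

lemma matrix_unit_mult:
  "matrix_unit a b ** matrix_unit c d = (if b = c then matrix_unit a d else (0 :: complex ^ 'm::finite ^ 'm))"
proof -
  have entry: "matrix_unit a b $ i $ k = (if k = b then (if i = a then 1 else 0) else 0)" for i k
    by (simp add: matrix_unit_def)
  have "(matrix_unit a b ** matrix_unit c d) $ i $ j = (if i = a then 1 else 0) * (matrix_unit c d $ b $ j :: complex)" for i j
    by (simp only: matrix_matrix_mult_def vec_lambda_beta entry sum_delta_mult)
  then show ?thesis
    by (simp add: vec_eq_iff matrix_unit_def)
qed

lemma matrix_star_unit: "matrix_star (matrix_unit a b) = matrix_unit b a"
  by (auto simp: vec_eq_iff matrix_star_def matrix_unit_def)

lemma sum_matrix_unit: "(\<Sum>a\<in>UNIV. matrix_unit a a) = (mat 1 :: complex ^ 'm ^ 'm)"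
proof -
  have "(\<Sum>a\<in>UNIV. if i = a \<and> j = a then 1 else 0) = (if i = j then 1 else (0::complex))" for i j :: 'm
    by (cases "i = j") (auto intro!: sum.neutral)
  then show ?thesis
    by (simp add: vec_eq_iff mat_def matrix_unit_def)
qed

lemma matrix_unit_expansion:
  "X = (\<Sum>a\<in>UNIV. \<Sum>b\<in>UNIV. matrix_scale (X $ a $ b) (matrix_unit a b))"
proof -
  have "(\<Sum>a\<in>UNIV. \<Sum>b\<in>UNIV. X $ a $ b * (if i = a \<and> j = b then 1 else 0)) = X $ i $ j" for i j
  proof -
    have "(\<Sum>b\<in>UNIV. X $ a $ b * (if i = a \<and> j = b then 1 else 0)) = (if a = i then X $ i $ j else 0)" for a
      by (cases "a = i") (simp_all add: if_distrib sum.delta cong: if_cong)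
    then show ?thesis
      by simp
  qed
  then show ?thesis
    by (simp add: vec_eq_iff matrix_scale_def matrix_unit_def)
qed

lemma rank_one_star: "matrix_star (rank_one v) = rank_one v"
  by (simp add: vec_eq_iff matrix_star_def rank_one_def mult.commute)

lemma rank_one_idem:
  fixes v :: "'m::finite \<Rightarrow> complex"
  assumes "(\<Sum>k\<in>UNIV. v k * cnj (v k)) = 1"
  shows "rank_one v ** rank_one v = rank_one v"
proof -
  have "(\<Sum>k\<in>UNIV. v i * cnj (v k) * (v k * cnj (v j))) = v i * cnj (v j)" for i j
  proof -
    have "(\<Sum>k\<in>UNIV. v i * cnj (v k) * (v k * cnj (v j))) = v i * cnj (v j) * (\<Sum>k\<in>UNIV. v k * cnj (v k))"
      unfolding sum_distrib_left by (rule sum.cong) (simp_all add: ac_simps)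
    then show ?thesis
      using assms by simp
  qed
  then show ?thesis
    by (simp add: vec_eq_iff matrix_matrix_mult_def rank_one_def)
qed

text \<open>The standard basis \<open>e\<^sub>a\<close> together with the unit vectors \<open>(e\<^sub>a + \<omega> e\<^sub>b) / \<surd>2\<close>, where \<open>\<omega> = 1\<close> and \<open>\<omega> = \<i>\<close> are
  enough for polarization.\<close>

definition basis_vector :: "'m \<Rightarrow> 'm \<Rightarrow> complex" where
  "basis_vector a i = (if i = a then 1 else 0)"

definition pair_vector :: "complex \<Rightarrow> 'm \<Rightarrow> 'm \<Rightarrow> 'm \<Rightarrow> complex" where
  "pair_vector \<omega> a b i = complex_of_real (1 / sqrt 2) * (basis_vector a i + \<omega> * basis_vector b i)"

definition polarizing_vectors :: "('m \<Rightarrow> complex) set" where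
  "polarizing_vectors = range basis_vector \<union>
     (\<lambda>(\<omega>, a, b). pair_vector \<omega> a b) ` ({1, \<i>} \<times> {(a, b). a \<noteq> b})"

lemma finite_polarizing_vectors: "finite (polarizing_vectors :: ('m::finite \<Rightarrow> complex) set)"
  by (simp add: polarizing_vectors_def)

lemma sqrt2_sq: "complex_of_real (1 / sqrt 2) * complex_of_real (1 / sqrt 2) = 1 / 2"
  by (simp flip: of_real_mult)

lemma polarizing_vectors_unit:
  fixes v :: "'m::finite \<Rightarrow> complex"
  assumes "v \<in> polarizing_vectors"
  shows "(\<Sum>k\<in>UNIV. v k * cnj (v k)) = 1"
proof -
  have 1: "(\<Sum>k\<in>UNIV. basis_vector a k * cnj (basis_vector a k)) = 1" for a :: 'm
    by (simp add: basis_vector_def if_distrib cong: if_cong)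
  have "(\<Sum>k\<in>UNIV. pair_vector \<omega> a b k * cnj (pair_vector \<omega> a b k)) = 1"
    if ab: "a \<noteq> b" and \<omega>: "\<omega> * cnj \<omega> = 1" for a b :: 'm and \<omega>
  proof -
    have "pair_vector \<omega> a b k * cnj (pair_vector \<omega> a b k) = 
        1/2 * (basis_vector a k * cnj (basis_vector a k) + basis_vector b k * cnj (basis_vector b k))" for k
    proof -
      have "pair_vector \<omega> a b k * cnj (pair_vector \<omega> a b k) =
        (complex_of_real (1 / sqrt 2) * complex_of_real (1 / sqrt 2)) *
        ((basis_vector a k + \<omega> * basis_vector b k) * cnj (basis_vector a k + \<omega> * basis_vector b k))"
        by (simp add: pair_vector_def)
      then show ?thesis
        using ab \<omega> unfolding sqrt2_sq by (auto simp: basis_vector_def)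
    qed
    then show ?thesis
      by (simp only: sum.distrib 1 sum_distrib_left[symmetric]) simp
  qed
  then show ?thesis
    using assms 1 by (auto simp: polarizing_vectors_def)
qed

text \<open>Polarization: every matrix unit, hence every matrix, is a linear combination of the
  projections onto the lines spanned by the polarizing vectors.\<close>

lemma matrix_induct_rank_one:
  fixes X :: "complex ^ 'm::finite ^ 'm"
  assumes add: "\<And>X Y. Q X \<Longrightarrow> Q Y \<Longrightarrow> Q (X + Y)"
    and scale: "\<And>c X. Q X \<Longrightarrow> Q (matrix_scale c X)"
    and rank_one: "\<And>v. v \<in> polarizing_vectors \<Longrightarrow> Q (rank_one v)"
  shows "Q X"
proof -
  have diag: "rank_one (basis_vector a) = matrix_unit a a" for a :: 'm
    by (auto simp: vec_eq_iff rank_one_def basis_vector_def matrix_unit_def)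
  have pair: "rank_one (pair_vector \<omega> a b) = matrix_scale (1/2) (matrix_unit a a + matrix_scale (\<omega> * cnj \<omega>) (matrix_unit b b)
      + matrix_scale (cnj \<omega>) (matrix_unit a b) + matrix_scale \<omega> (matrix_unit b a))" for \<omega> and a b :: 'm
  proof -
    have "pair_vector \<omega> a b i * cnj (pair_vector \<omega> a b j) =
        (complex_of_real (1 / sqrt 2) * complex_of_real (1 / sqrt 2)) *
        ((basis_vector a i + \<omega> * basis_vector b i) * cnj (basis_vector a j + \<omega> * basis_vector b j))" for i j
      by (simp add: pair_vector_def)
    then show ?thesis
      unfolding sqrt2_sq
      by (simp add: vec_eq_iff rank_one_def matrix_scale_def matrix_unit_def basis_vector_def algebra_simps)
  qed
  have unit: "Q (matrix_unit a b)" for a b :: 'm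
  proof (cases "a = b")
    case True
    then show ?thesis
      using rank_one[of "basis_vector a"] by (simp add: polarizing_vectors_def diag)
  next
    case False
    have aa: "Q (matrix_unit a a)" for a :: 'm
      using rank_one[of "basis_vector a"] by (simp add: polarizing_vectors_def diag)
    \<comment> \<open>\<open>\<omega> = 1\<close> contributes the sum of the two off-diagonal units and \<open>\<i>\<close> times \<open>\<omega> = \<i>\<close> their difference.\<close>
    have "Q (rank_one (pair_vector 1 a b))" "Q (rank_one (pair_vector \<i> a b))"
      using False by (force intro!: rank_one simp: polarizing_vectors_def)+
    then have "Q (rank_one (pair_vector 1 a b) + matrix_scale \<i> (rank_one (pair_vector \<i> a b))
        + matrix_scale (- (1 + \<i>) / 2) (matrix_unit a a + matrix_unit b b))"
      by (intro add[OF add[OF _ scale] scale[OF add[OF aa aa]]])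
    moreover have "rank_one (pair_vector 1 a b) + matrix_scale \<i> (rank_one (pair_vector \<i> a b))
        + matrix_scale (- (1 + \<i>) / 2) (matrix_unit a a + matrix_unit b b) = matrix_unit a b"
    proof -
      have "1/2 * (p + 1 * cnj 1 * q + cnj 1 * r + 1 * s) + \<i> * (1/2 * (p + \<i> * cnj \<i> * q + cnj \<i> * r + \<i> * s))
          + (- (1 + \<i>) / 2) * (p + q) = r" for p q r s
        by (simp add: complex_eq_iff field_simps)
      then show ?thesis
        unfolding pair vec_eq_iff matrix_scale_def vector_add_component vec_lambda_beta by (intro allI)
    qed
    ultimately show ?thesis
      by simp
  qed
  have "Q 0"
    using scale[OF unit, of 0 undefined undefined] by (simp add: matrix_scale_def zero_vec_def)
  have sum: "Q (sum F I)" if "\<And>i. i \<in> I \<Longrightarrow> Q (F i)" for F :: "'m \<Rightarrow> complex ^ 'm ^ 'm" and I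
    using that by (induction I rule: infinite_finite_induct) (auto intro: add \<open>Q 0\<close>)
  have "Q (\<Sum>a\<in>UNIV. \<Sum>b\<in>UNIV. matrix_scale (X $ a $ b) (matrix_unit a b))"
    by (intro sum scale unit)
  then show ?thesis
    using matrix_unit_expansion[of X] by simp
qed

text \<open>The matrix that sends the basis vector \<open>e\<^sub>j\<close> to \<open>\<plusminus> e\<^bsub>\<sigma> j\<^esub>\<close>.\<close>

definition signed_permutation :: "('m \<Rightarrow> 'm) \<times> ('m \<Rightarrow> bool) \<Rightarrow> complex ^ 'm ^ 'm" where
  "signed_permutation g = (\<chi> i j. if i = fst g j then (if snd g j then 1 else - 1) else 0)"

definition signed_permutations :: "(('m \<Rightarrow> 'm) \<times> ('m \<Rightarrow> bool)) set" where
  "signed_permutations = {\<sigma>. bij \<sigma>} \<times> UNIV"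

lemma signed_permutations_finite: "finite (signed_permutations :: (('m::finite \<Rightarrow> 'm) \<times> ('m \<Rightarrow> bool)) set)"
  and signed_permutations_nonempty: "signed_permutations \<noteq> ({} :: (('m::finite \<Rightarrow> 'm) \<times> ('m \<Rightarrow> bool)) set)"
  using bij_id by (auto simp: signed_permutations_def)

lemma signed_permutation_conj:
  fixes X :: "complex ^ 'm::finite ^ 'm"
  shows "(matrix_star (signed_permutation g) ** X ** signed_permutation g) $ j $ l
    = (if snd g j then 1 else - 1) * X $ (fst g j) $ (fst g l) * (if snd g l then 1 else - 1)"
proof -
  have star: "matrix_star (signed_permutation g) $ j $ i
      = (if i = fst g j then (if snd g j then 1 else - 1) else 0)" for i
    by (simp add: matrix_star_def signed_permutation_def)
  have entry: "signed_permutation g $ k $ l = (if k = fst g l then (if snd g l then 1 else - 1) else 0)" for k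
    by (simp add: signed_permutation_def)
  show ?thesis
    by (simp only: matrix_matrix_mult_def vec_lambda_beta star entry sum_delta_mult)
qed

lemma signed_permutation_unitary:
  fixes g :: "('m::finite \<Rightarrow> 'm) \<times> ('m \<Rightarrow> bool)"
  assumes "g \<in> signed_permutations"
  shows "matrix_star (signed_permutation g) ** signed_permutation g = mat 1"
    "signed_permutation g ** matrix_star (signed_permutation g) = mat 1"
proof -
  have inj: "inj (fst g)"
    using assms unfolding signed_permutations_def mem_Times_iff bij_def by simp
  have "(matrix_star (signed_permutation g) ** mat 1 ** signed_permutation g) $ j $ l = (mat 1 :: complex ^ 'm ^ 'm) $ j $ l" for j l
    unfolding signed_permutation_conj by (simp add: mat_def inj_eq[OF inj])
  then show "matrix_star (signed_permutation g) ** signed_permutation g = mat 1"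
    by (simp add: vec_eq_iff)
  then show "signed_permutation g ** matrix_star (signed_permutation g) = mat 1"
    by (simp add: matrix_left_right_inverse)
qed

text \<open>Averaging over the signs kills the off-diagonal entries, and averaging over the permutations
  makes the diagonal constant.\<close>

lemma signed_permutation_average:
  fixes X :: "complex ^ 'm::finite ^ 'm"
  shows "\<exists>c. (\<Sum>g\<in>signed_permutations. matrix_star (signed_permutation g) ** X ** signed_permutation g)
    = matrix_scale c (mat 1)"
proof -
  define F where "F g = matrix_star (signed_permutation g) ** X ** signed_permutation g" for g :: "('m \<Rightarrow> 'm) \<times> ('m \<Rightarrow> bool)"
  let ?G = "signed_permutations :: (('m \<Rightarrow> 'm) \<times> ('m \<Rightarrow> bool)) set"
  have off: "(\<Sum>g\<in>?G. F g $ j $ l) = 0" if "j \<noteq> l" for j l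
  proof -
    define flip :: "('m \<Rightarrow> 'm) \<times> ('m \<Rightarrow> bool) \<Rightarrow> ('m \<Rightarrow> 'm) \<times> ('m \<Rightarrow> bool)"
      where "flip g = (fst g, (snd g)(j := \<not> snd g j))" for g
    have "(\<Sum>g\<in>?G. F g $ j $ l) = (\<Sum>g\<in>?G. F (flip g) $ j $ l)"
      by (rule sum.reindex_bij_witness[where i = flip and j = flip])
        (auto simp: flip_def signed_permutations_def)
    also have "\<dots> = (\<Sum>g\<in>?G. - (F g $ j $ l))"
      using that by (intro sum.cong) (auto simp: F_def signed_permutation_conj flip_def)
    finally show ?thesis
      by (simp add: sum_negf)
  qed
  have diag: "(\<Sum>g\<in>?G. F g $ j $ j) = (\<Sum>g\<in>?G. F g $ l $ l)" for j l
  proof -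
    define swap :: "('m \<Rightarrow> 'm) \<times> ('m \<Rightarrow> bool) \<Rightarrow> ('m \<Rightarrow> 'm) \<times> ('m \<Rightarrow> bool)"
      where "swap g = (fst g \<circ> Transposition.transpose j l, snd g)" for g
    have "bij (\<sigma> \<circ> Transposition.transpose j l)" if "bij \<sigma>" for \<sigma> :: "'m \<Rightarrow> 'm"
      using that by (intro bij_comp) auto
    then have "(\<Sum>g\<in>?G. F g $ j $ j) = (\<Sum>g\<in>?G. F (swap g) $ j $ j)"
      by (intro sum.reindex_bij_witness[where i = swap and j = swap])
        (auto simp: swap_def signed_permutations_def o_assoc[symmetric])
    also have "\<dots> = (\<Sum>g\<in>?G. F g $ l $ l)"
      by (intro sum.cong) (auto simp: F_def signed_permutation_conj swap_def)
    finally show ?thesis .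
  qed
  have "sum F ?G = matrix_scale (\<Sum>g\<in>?G. F g $ undefined $ undefined) (mat 1)"
    using off diag[of _ undefined] by (auto simp: vec_eq_iff matrix_scale_def mat_def)
  then show ?thesis
    unfolding F_def by blast
qed

section \<open>Equal partitions commuting with a subalgebra\<close>

lemma state_linear:
  assumes M: "von_neumann_algebra M" and \<phi>: "state_on M \<phi>" and x: "x \<in> M"
  shows "y \<in> M \<Longrightarrow> \<phi> (x + y) = \<phi> x + \<phi> y" "y \<in> M \<Longrightarrow> \<phi> (x - y) = \<phi> x - \<phi> y" "\<phi> (scaleC_op c x) = c * \<phi> x"
proof -
  have add: "\<phi> (x + y) = \<phi> x + \<phi> y" if "x \<in> M" "y \<in> M" for x y
    using \<phi> that by (simp add: state_on_def)
  then show "y \<in> M \<Longrightarrow> \<phi> (x + y) = \<phi> x + \<phi> y"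
    using x by simp
  show "y \<in> M \<Longrightarrow> \<phi> (x - y) = \<phi> x - \<phi> y"
    using add[of "x - y" y] vn_closure(2)[OF M x, of y] by simp
  show "\<phi> (scaleC_op c x) = c * \<phi> x"
    using \<phi> x by (simp add: state_on_def)
qed

lemma state_zero:
  assumes "von_neumann_algebra M" "state_on M \<phi>"
  shows "\<phi> 0 = 0"
  using state_linear(2)[OF assms vn_zero_id(1)[OF assms(1)] vn_zero_id(1)[OF assms(1)]] by simp

lemma state_sum:
  assumes "von_neumann_algebra M" "state_on M \<phi>" "\<And>i. i \<in> I \<Longrightarrow> f i \<in> M"
  shows "\<phi> (sum f I) = (\<Sum>i\<in>I. \<phi> (f i))"
  using assms(3)
proof (induction I rule: infinite_finite_induct)
  case (insert i I)
  then have "sum f I \<in> M"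
    by (intro vn_sum[OF assms(1)]) auto
  then show ?case
    using insert state_linear(1)[OF assms(1,2)] by simp
qed (simp_all add: state_zero[OF assms(1,2)])

lemma state_projection:
  assumes "state_on M \<phi>" "p \<in> M" "is_projection p"
  shows "0 \<le> Re (\<phi> p)" "\<phi> p = complex_of_real (Re (\<phi> p))"
proof -
  have "\<phi> (cadj p o\<^sub>L p) \<in> \<real>\<^sub>\<ge>\<^sub>0"
    using assms by (simp add: state_on_def)
  then have "\<phi> p \<in> \<real>\<^sub>\<ge>\<^sub>0"
    using assms(3) by (simp add: is_projection_def)
  then show "0 \<le> Re (\<phi> p)" "\<phi> p = complex_of_real (Re (\<phi> p))"
    by (auto simp: complex_nonneg_Reals_iff complex_eq_iff)
qed

lemma projection_diff_le:
  assumes "is_projection p" "is_projection q" "op_le q p"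
  shows "is_projection (p - q)"
  using assms projection_diff projection_le_iff by blast

lemma state_projection_mono:
  assumes M: "von_neumann_algebra M" and \<phi>: "state_on M \<phi>"
    and "p \<in> M" "is_projection p" "q \<in> M" "is_projection q" "op_le q p"
  shows "Re (\<phi> q) \<le> Re (\<phi> p)"
  using state_projection(1)[OF \<phi> vn_closure(2)[OF M] projection_diff_le, of p q] assms
  by (simp add: state_linear(2)[OF M \<phi>])

lemma projection_compose:
  assumes "is_projection p" "is_projection q" "p o\<^sub>L q = q o\<^sub>L p"
  shows "is_projection (p o\<^sub>L q)"
proof -
  have "(p o\<^sub>L q) o\<^sub>L (p o\<^sub>L q) = (p o\<^sub>L p) o\<^sub>L (q o\<^sub>L q)"
    using assms(3) by (metis compose_assoc)
  then show ?thesis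
    using assms by (simp add: is_projection_def bounded_ops_closure cadj_compose)
qed

text \<open>The projections of the relative commutant of \<open>A\<close> in \<open>M\<close>.\<close>

definition commuting_projections :: "'h::complex_hilbert operator set \<Rightarrow> 'h operator set \<Rightarrow> 'h operator set" where
  "commuting_projections M A = {p \<in> M. is_projection p \<and> (\<forall>a\<in>A. p o\<^sub>L a = a o\<^sub>L p)}"

text \<open>A chain of projections is a bounded increasing net whose supremum a normal state preserves.\<close>

lemma normal_state_approximates_sup:
  assumes M: "von_neumann_algebra M" and \<phi>: "normal_state_on M \<phi>"
    and C: "\<And>c. c \<in> C \<Longrightarrow> c \<in> M \<and> is_projection c" "C \<noteq> {}"
    and chain: "\<And>a b. a \<in> C \<Longrightarrow> b \<in> C \<Longrightarrow> op_le a b \<or> op_le b a"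
    and s: "s \<in> M" "is_projection s" "\<And>c. c \<in> C \<Longrightarrow> op_le c s"
      "\<And>y. (\<And>c. c \<in> C \<Longrightarrow> op_le c y) \<Longrightarrow> op_le s y"
    and e: "e > 0"
  shows "\<exists>c\<in>C. Re (\<phi> s) < Re (\<phi> c) + e"
proof -
  have "C \<subseteq> selfadjoint_part M"
    using C by (auto simp: selfadjoint_part_def is_projection_def)
  moreover have "directed_up C"
    unfolding directed_up_def using C(2) chain op_le_refl by blast
  moreover have "is_op_sup M C s"
    using s by (auto simp: is_op_sup_def selfadjoint_part_def is_projection_def)
  ultimately have eq: "Re (\<phi> s) = (SUP x\<in>C. Re (\<phi> x))"
    using \<phi> unfolding normal_state_on_def by blast
  have "bdd_above ((\<lambda>x. Re (\<phi> x)) ` C)"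
    by (rule bdd_aboveI2[where M = "Re (\<phi> s)"], rule state_projection_mono[OF M])
      (use \<phi> C s in \<open>auto simp: normal_state_on_def\<close>)
  then have "\<exists>c\<in>C. Re (\<phi> s) - e < Re (\<phi> c)"
    using less_cSUP_iff[OF C(2), of "\<lambda>x. Re (\<phi> x)" "Re (\<phi> s) - e"] e eq by simp
  then show ?thesis
    by (auto simp: algebra_simps)
qed

text \<open>In a chain the elements that approximate the finitely many summands can be replaced by the largest
  of them.\<close>

lemma chain_approximates_sum:
  fixes F :: "'i \<Rightarrow> 'a \<Rightarrow> real"
  assumes "finite I" "C \<noteq> {}"
    and chain: "\<And>a b. a \<in> C \<Longrightarrow> b \<in> C \<Longrightarrow> le a b \<or> le b a"
    and mono: "\<And>i a b. i \<in> I \<Longrightarrow> a \<in> C \<Longrightarrow> b \<in> C \<Longrightarrow> le a b \<Longrightarrow> F i a \<le> F i b"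
    and approx: "\<And>i e. i \<in> I \<Longrightarrow> e > 0 \<Longrightarrow> \<exists>c\<in>C. F i s < F i c + e"
    and "e > 0"
  shows "\<exists>c\<in>C. (\<Sum>i\<in>I. F i s) < (\<Sum>i\<in>I. F i c) + e"
  using assms(1) mono approx \<open>e > 0\<close>
proof (induction I arbitrary: e rule: finite_induct)
  case empty
  then show ?case
    using \<open>C \<noteq> {}\<close> by auto
next
  case (insert i I)
  have "\<exists>c\<in>C. (\<Sum>i\<in>I. F i s) < (\<Sum>i\<in>I. F i c) + e / 2"
    by (rule insert.IH) (use insert.prems in auto)
  then obtain a where a: "a \<in> C" "(\<Sum>i\<in>I. F i s) < (\<Sum>i\<in>I. F i a) + e / 2"
    by blast
  obtain b where b: "b \<in> C" "F i s < F i b + e / 2"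
    using insert.prems(2)[of i "e / 2"] insert.prems(3) by auto
  obtain c where c: "c \<in> C" "c = a \<or> le a c" "c = b \<or> le b c"
    using a(1) b(1) chain by blast
  have "F i b \<le> F i c"
    using c b insert.prems(1)[of i b c] by auto
  moreover have "(\<Sum>i\<in>I. F i a) \<le> (\<Sum>i\<in>I. F i c)"
    using c a insert.prems(1) by (intro sum_mono) auto
  ultimately show ?case
    using a b c(1) insert.hyps by (intro bexI[of _ c]) auto
qed

text \<open>The supremum of a chain, formed among all operators, commutes with every operator that commutes with
  the chain together with its adjoint. As \<open>A\<close> and the commutant of \<open>M\<close> are closed under adjoints, the supremum
  commutes with both and so remains in the set.\<close>

lemma commuting_projections_continuous:
  fixes M A :: "'h::complex_hilbert operator set"
  assumes M: "von_neumann_algebra M" and A: "A \<subseteq> M" "\<And>a. a \<in> A \<Longrightarrow> cadj a \<in> A"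
    and split: "\<And>p. p \<in> commuting_projections M A \<Longrightarrow> p \<noteq> 0 \<Longrightarrow>
      \<exists>q\<in>commuting_projections M A. op_le q p \<and> q \<noteq> 0 \<and> q \<noteq> p"
    and I: "finite I" and \<phi>: "\<And>i. i \<in> I \<Longrightarrow> normal_state_on M (\<phi> i)"
  shows "continuous_projections (commuting_projections M A) op_le (\<lambda>x. \<Sum>i\<in>I. Re (\<phi> i x))"
proof
  have st: "state_on M (\<phi> i)" if "i \<in> I" for i
    using \<phi>[OF that] by (simp add: normal_state_on_def)
  let ?P = "commuting_projections M A"
  have PD: "p \<in> M" "is_projection p" "\<And>a. a \<in> A \<Longrightarrow> p o\<^sub>L a = a o\<^sub>L p" if "p \<in> ?P" for p
    using that by (auto simp: commuting_projections_def)
  show "op_le p p" for p :: "'h operator"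
    by (rule op_le_refl)
  show "op_le p r" if "op_le p q" "op_le q r" for p q r :: "'h operator"
    using that by (rule op_le_trans)
  show "p = q" if "p \<in> ?P" "q \<in> ?P" "op_le p q" "op_le q p" for p q
    using projection_le_antisym that PD by blast
  show "op_le (x + z) (y + z)" if "op_le x y" for x y z :: "'h operator"
    using that by (rule op_le_add)
  show "op_le (z - y) (z - x)" if "op_le x y" for x y z :: "'h operator"
    using that by (rule op_le_flip)
  show "0 \<in> ?P"
    using vn_zero_id[OF M] by (simp add: commuting_projections_def is_projection_def compose_simps)
  show "op_le 0 p" if "p \<in> ?P" for p
    using PD[OF that] projection_nonneg by blast
  show "p - q \<in> ?P" if "p \<in> ?P" "q \<in> ?P" "op_le q p" for p q
    using PD[OF that(1)] PD[OF that(2)] that(3) vn_closure(2)[OF M] projection_diff_le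
    by (simp add: commuting_projections_def compose_simps)
  show "0 \<le> (\<Sum>i\<in>I. Re (\<phi> i p))" if "p \<in> ?P" for p
    using PD[OF that] state_projection(1)[OF st] by (intro sum_nonneg) blast
  show "(\<Sum>i\<in>I. Re (\<phi> i (p - q))) = (\<Sum>i\<in>I. Re (\<phi> i p)) - (\<Sum>i\<in>I. Re (\<phi> i q))"
    if "p \<in> ?P" "q \<in> ?P" "op_le q p" for p q
    using PD[OF that(1)] PD[OF that(2)] by (simp add: state_linear(2)[OF M st] flip: sum_subtractf)
  show "\<exists>q\<in>?P. op_le q p \<and> q \<noteq> 0 \<and> q \<noteq> p" if "p \<in> ?P" "p \<noteq> 0" for p
    using split that by blast
  fix C assume C: "C \<subseteq> ?P" "C \<noteq> {}" and chain: "\<And>a b. a \<in> C \<Longrightarrow> b \<in> C \<Longrightarrow> op_le a b \<or> op_le b a"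
  have CD: "c \<in> M" "is_projection c" "\<And>a. a \<in> A \<Longrightarrow> c o\<^sub>L a = a o\<^sub>L c" if "c \<in> C" for c
    using PD C that by blast+
  obtain s where s: "is_projection s" "\<And>c. c \<in> C \<Longrightarrow> op_le c s"
      "\<And>y. (\<And>c. c \<in> C \<Longrightarrow> op_le c y) \<Longrightarrow> op_le s y"
    and sc: "\<And>T. T \<in> bounded_ops \<Longrightarrow> (\<And>c. c \<in> C \<Longrightarrow> T o\<^sub>L c = c o\<^sub>L T) \<Longrightarrow>
      (\<And>c. c \<in> C \<Longrightarrow> cadj T o\<^sub>L c = c o\<^sub>L cadj T) \<Longrightarrow> T o\<^sub>L s = s o\<^sub>L T"
    using projection_chain_sup[OF CD(2) C(2) chain] by (metis (no_types, lifting))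
  have sM: "s \<in> M"
    by (rule vn_memI[OF M is_projection_apply(1)[OF s(1)]], rule sc[symmetric])
      (use commutantD commutant_cadj[OF M] CD in blast)+
  have "s o\<^sub>L a = a o\<^sub>L s" if "a \<in> A" for a
    using sc[of a, symmetric] CD(3)[OF _ that, symmetric] CD(3)[OF _ A(2)[OF that], symmetric]
      vn_bounded[OF M] A(1) that by blast
  then have "s \<in> ?P"
    using sM s(1) by (simp add: commuting_projections_def)
  moreover have "\<exists>c\<in>C. (\<Sum>i\<in>I. Re (\<phi> i s)) < (\<Sum>i\<in>I. Re (\<phi> i c)) + e" if "e > 0" for e
  proof (rule chain_approximates_sum[OF I C(2) chain _ _ that, where F = "\<lambda>i x. Re (\<phi> i x)"])
    show "Re (\<phi> i a) \<le> Re (\<phi> i b)" if "i \<in> I" "a \<in> C" "b \<in> C" "op_le a b" for i a b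
      using state_projection_mono[OF M st] CD that by blast
    show "\<exists>c\<in>C. Re (\<phi> i s) < Re (\<phi> i c) + e" if "i \<in> I" "e > 0" for i e
      by (rule normal_state_approximates_sup[OF M \<phi>[OF that(1)] _ C(2) chain sM s that(2)])
        (use CD in auto)
  qed
  ultimately show "\<exists>s\<in>?P. (\<forall>c\<in>C. op_le c s) \<and> (\<forall>y\<in>?P. (\<forall>c\<in>C. op_le c y) \<longrightarrow> op_le s y) \<and>
      (\<forall>e>0. \<exists>c\<in>C. (\<Sum>i\<in>I. Re (\<phi> i s)) < (\<Sum>i\<in>I. Re (\<phi> i c)) + e)"
    using s by blast
qed

text \<open>For a projection \<open>e \<in> A\<close> the functional \<open>x \<mapsto> \<phi>\<^sub>i (x e)\<close> is nonnegative on projections commuting with \<open>A\<close>, since \<open>x e\<close> is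
  a projection below \<open>x\<close>, and so it is dominated by \<open>\<phi>\<^sub>i\<close> and by the sum \<open>\<Psi>\<close> of all \<open>\<phi>\<^sub>i\<close>. The
  increments of the flow over \<open>n\<close> intervals of equal length form the partition.\<close>

lemma equal_partition_exists:
  fixes M A E :: "'h::complex_hilbert operator set" and \<phi> :: "'i \<Rightarrow> 'h operator \<Rightarrow> complex"
  assumes M: "von_neumann_algebra M" and A: "A \<subseteq> M" "\<And>a. a \<in> A \<Longrightarrow> cadj a \<in> A"
    and split: "\<And>p. p \<in> commuting_projections M A \<Longrightarrow> p \<noteq> 0 \<Longrightarrow>
      \<exists>q\<in>commuting_projections M A. op_le q p \<and> q \<noteq> 0 \<and> q \<noteq> p"
    and I: "finite I" and \<phi>: "\<And>i. i \<in> I \<Longrightarrow> normal_state_on M (\<phi> i)"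
    and E: "finite E" "E \<subseteq> A" "\<And>e. e \<in> E \<Longrightarrow> is_projection e" and n: "n > 0"
  shows "\<exists>q. (\<forall>j<n. q j \<in> commuting_projections M A) \<and> (\<forall>i<n. \<forall>j<n. i \<noteq> j \<longrightarrow> q i o\<^sub>L q j = 0) \<and>
    (\<Sum>j<n. q j) = id_blinfun \<and> (\<forall>j<n. \<forall>i\<in>I. \<forall>e\<in>E. \<phi> i (q j o\<^sub>L e) = \<phi> i e / of_nat n)"
proof -
  let ?P = "commuting_projections M A"
  let ?\<Psi> = "\<lambda>x. \<Sum>i\<in>I. Re (\<phi> i x)"
  interpret continuous_projections ?P op_le ?\<Psi>
    by (rule commuting_projections_continuous[OF M A split I \<phi>])
  have st: "state_on M (\<phi> i)" if "i \<in> I" for i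
    using \<phi>[OF that] by (simp add: normal_state_on_def)
  have PD: "p \<in> M" "is_projection p" "\<And>a. a \<in> A \<Longrightarrow> p o\<^sub>L a = a o\<^sub>L p" if "p \<in> ?P" for p
    using that by (auto simp: commuting_projections_def)
  have EM: "e \<in> M" "is_projection e" if "e \<in> E" for e
    using E A that by auto
  have pe: "p o\<^sub>L e \<in> M" "is_projection (p o\<^sub>L e)" if "p \<in> ?P" "e \<in> E" for p e
    using vn_closure(3)[OF M] PD[OF that(1)] EM[OF that(2)] projection_compose E that by blast+
  define \<psi> :: "'i \<times> 'h operator \<Rightarrow> 'h operator \<Rightarrow> real"
    where "\<psi> = (\<lambda>(i, e) x. Re (\<phi> i (x o\<^sub>L e)))"
  have "dominated (\<psi> ie)" if ie: "ie \<in> I \<times> E" for ie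
  proof -
    obtain i e where [simp]: "ie = (i, e)" and i: "i \<in> I" and e: "e \<in> E"
      using ie by auto
    have "0 \<le> Re (\<phi> i (p o\<^sub>L e)) \<and> Re (\<phi> i (p o\<^sub>L e)) \<le> ?\<Psi> p" if p: "p \<in> ?P" for p
    proof
      note pm = PD[OF p] pe[OF p e]
      show "0 \<le> Re (\<phi> i (p o\<^sub>L e))"
        using state_projection(1)[OF st[OF i]] pm by blast
      have "p o\<^sub>L (p o\<^sub>L e) = p o\<^sub>L e"
        using pm(2) by (simp add: is_projection_def flip: compose_assoc)
      then have "op_le (p o\<^sub>L e) p"
        using projection_le_iff pm by blast
      then have "Re (\<phi> i (p o\<^sub>L e)) \<le> Re (\<phi> i p)"
        using state_projection_mono[OF M st[OF i]] pm by blast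
      also have "\<dots> \<le> ?\<Psi> p"
        using i I pm state_projection(1)[OF st] by (intro member_le_sum) auto
      finally show "Re (\<phi> i (p o\<^sub>L e)) \<le> ?\<Psi> p" .
    qed
    moreover have "\<phi> i ((p - q) o\<^sub>L e) = \<phi> i (p o\<^sub>L e) - \<phi> i (q o\<^sub>L e)" if "p \<in> ?P" "q \<in> ?P" for p q
      using pe(1)[OF that(1) e] pe(1)[OF that(2) e] by (simp add: compose_simps state_linear(2)[OF M st[OF i]])
    ultimately show ?thesis
      by (simp add: dominated_def \<psi>_def)
  qed
  moreover have "id_blinfun \<in> ?P"
    using vn_zero_id[OF M] by (simp add: commuting_projections_def is_projection_def compose_simps)
  ultimately obtain c where c: "proportional_flow (insert ?\<Psi> (\<psi> ` (I \<times> E))) id_blinfun c"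
    using proportional_flow_exists[of "\<psi> ` (I \<times> E)" id_blinfun] I E by auto
  have c01: "c 0 = 0" "c 1 = id_blinfun"
    using c by (auto simp: proportional_flow_def)
  have cP: "c t \<in> ?P" if "0 \<le> t" "t \<le> 1" for t
    using c that by (auto simp: proportional_flow_def)
  have mono: "op_le (c s) (c t)" if "0 \<le> s" "s \<le> t" "t \<le> 1" for s t
    using c that by (auto simp: proportional_flow_def)
  have flow: "Re (\<phi> i (c t o\<^sub>L e)) = t * Re (\<phi> i e)" if "0 \<le> t" "t \<le> 1" "i \<in> I" "e \<in> E" for t i e
  proof -
    have "\<psi> (i, e) (c t) = t * \<psi> (i, e) id_blinfun"
      using c that unfolding proportional_flow_def by auto
    then show ?thesis
      by (simp add: \<psi>_def compose_simps)
  qed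
  define d where "d j = c (real j / real n)" for j
  have dP: "d j \<in> ?P" if "j \<le> n" for j
    using that n by (auto simp: d_def intro: cP)
  have dmono: "op_le (d i) (d j)" if "i \<le> j" "j \<le> n" for i j
    using that n by (auto simp: d_def divide_right_mono intro!: mono)
  have dd: "d j o\<^sub>L d i = d i" "d i o\<^sub>L d j = d i" if "i \<le> j" "j \<le> n" for i j
    using projection_le_commute[of "d j" "d i"] PD(2)[OF dP] dmono that by auto
  define q where "q j = d (Suc j) - d j" for j
  have qP: "q j \<in> ?P" if "j < n" for j
    using that dP dmono diff_in by (simp add: q_def)
  have q_below: "q i o\<^sub>L q j = 0" "q j o\<^sub>L q i = 0" if "i < j" "j < n" for i j
    using that by (simp_all add: q_def compose_simps dd)
  have "(\<Sum>j<n. q j) = id_blinfun"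
    unfolding q_def sum_lessThan_telescope using n c01 by (simp add: d_def)
  moreover have "\<phi> i (q j o\<^sub>L e) = \<phi> i e / of_nat n" if "j < n" "i \<in> I" "e \<in> E" for i j e
  proof -
    have "Re (\<phi> i (q j o\<^sub>L e)) = Re (\<phi> i (d (Suc j) o\<^sub>L e)) - Re (\<phi> i (d j o\<^sub>L e))"
      using pe(1)[OF dP \<open>e \<in> E\<close>, of "Suc j"] pe(1)[OF dP \<open>e \<in> E\<close>, of j] \<open>j < n\<close>
      by (simp add: q_def compose_simps state_linear(2)[OF M st[OF \<open>i \<in> I\<close>]])
    also have "\<dots> = Re (\<phi> i e) / real n"
      using that flow by (simp add: d_def divide_simps algebra_simps)
    finally have "complex_of_real (Re (\<phi> i (q j o\<^sub>L e))) = complex_of_real (Re (\<phi> i e)) / of_nat n"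
      by simp
    then show ?thesis
      using state_projection(2)[OF st[OF \<open>i \<in> I\<close>] pe[OF qP[OF \<open>j < n\<close>] \<open>e \<in> E\<close>]]
        state_projection(2)[OF st[OF \<open>i \<in> I\<close>] EM[OF \<open>e \<in> E\<close>]] by simp
  qed
  ultimately show ?thesis
    using qP q_below by (intro exI[of _ q]) (metis linorder_neqE_nat)
qed

section \<open>The unitary\<close>

locale unital_matrix_subalgebra =
  fixes M A :: "'h::complex_hilbert operator set" and \<pi> :: "complex ^ 'm ^ 'm \<Rightarrow> 'h operator"
  assumes M: "von_neumann_algebra M" and A: "cstar_subalgebra A M"
    and iso: "matrix_star_iso \<pi> A" and one: "id_blinfun \<in> A"
begin

lemma pi_add: "\<pi> (X + Y) = \<pi> X + \<pi> Y"
  and pi_scale: "\<pi> (matrix_scale c X) = scaleC_op c (\<pi> X)"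
  and pi_mult: "\<pi> (X ** Y) = \<pi> X o\<^sub>L \<pi> Y"
  and pi_star: "\<pi> (matrix_star X) = cadj (\<pi> X)"
  using iso by (simp_all add: matrix_star_iso_def matrix_scale_def matrix_star_def)

lemma pi_in: "\<pi> X \<in> A" "\<pi> X \<in> M" "\<pi> X \<in> bounded_ops"
proof -
  show "\<pi> X \<in> A"
    using iso by (auto simp: matrix_star_iso_def bij_betw_def)
  then show "\<pi> X \<in> M"
    using A by (auto simp: cstar_subalgebra_def)
  then show "\<pi> X \<in> bounded_ops"
    by (rule vn_bounded[OF M])
qed

lemma pi_surj: "a \<in> A \<Longrightarrow> \<exists>X. a = \<pi> X"
  using iso by (auto simp: matrix_star_iso_def bij_betw_def)

lemma subalgebra_cadj: "a \<in> A \<Longrightarrow> cadj a \<in> A" and subalgebra_subset: "A \<subseteq> M"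
  using A by (simp_all add: cstar_subalgebra_def)

lemma pi_one: "\<pi> (mat 1) = id_blinfun"
proof -
  obtain X where X: "id_blinfun = \<pi> X"
    using pi_surj[OF one] by blast
  have "\<pi> (mat 1) = \<pi> (mat 1) o\<^sub>L \<pi> X"
    by (simp add: compose_simps flip: X)
  also have "\<dots> = \<pi> X"
    by (simp flip: pi_mult)
  finally show ?thesis
    using X by simp
qed

lemma pi_zero: "\<pi> 0 = 0"
  using pi_add[of 0 0] by simp

lemma pi_sum: "\<pi> (sum F I) = (\<Sum>i\<in>I. \<pi> (F i))"
  by (induction I rule: infinite_finite_induct) (simp_all add: pi_zero pi_add)

lemma cadj_sum:
  assumes "\<And>i. i \<in> I \<Longrightarrow> F i \<in> M"
  shows "cadj (\<Sum>i\<in>I. F i) = (\<Sum>i\<in>I. cadj (F i))"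
  using assms
proof (induction I rule: infinite_finite_induct)
  case (insert i I)
  then show ?case
    using vn_bounded[OF M] vn_sum[OF M, of I F] by (simp add: cadj_add)
qed simp_all

definition unit_op :: "'m \<Rightarrow> 'm \<Rightarrow> 'h operator" where
  "unit_op a b = \<pi> (matrix_unit a b)"

lemma unit_op_mult: "unit_op a b o\<^sub>L unit_op c d = (if b = c then unit_op a d else 0)"
  by (simp add: unit_op_def matrix_unit_mult pi_zero flip: pi_mult)

lemma unit_op_mult': 
  fixes T :: "'h operator"
  shows "unit_op a b o\<^sub>L (unit_op c d o\<^sub>L T) = (if b = c then unit_op a d o\<^sub>L T else 0)"
  by (simp add: unit_op_mult compose_simps flip: compose_assoc)

lemma unit_op_in: "unit_op a b \<in> A" "unit_op a b \<in> M" "unit_op a b \<in> bounded_ops"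
  by (simp_all add: unit_op_def pi_in)

lemma cadj_unit_op: "cadj (unit_op a b) = unit_op b a"
  by (simp add: unit_op_def matrix_star_unit flip: pi_star)

lemma sum_unit_op: "(\<Sum>a\<in>UNIV. unit_op a a) = id_blinfun"
  by (simp add: unit_op_def sum_matrix_unit pi_one flip: pi_sum)

lemma commutes_with_subalgebraI:
  assumes T: "T \<in> bounded_ops" and comm: "\<And>a b. T o\<^sub>L unit_op a b = unit_op a b o\<^sub>L T" and x: "x \<in> A"
  shows "T o\<^sub>L x = x o\<^sub>L T"
proof -
  obtain X where X: "x = \<pi> X"
    using pi_surj[OF x] by blast
  have "\<pi> X = (\<Sum>a\<in>UNIV. \<Sum>b\<in>UNIV. scaleC_op (X $ a $ b) (unit_op a b))"
    by (subst matrix_unit_expansion) (simp add: pi_sum pi_scale unit_op_def)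
  then show ?thesis
    unfolding X by (simp add: compose_sum compose_simps compose_scaleC_right[OF T] comm)
qed

text \<open>Cutting down by a diagonal matrix unit \<open>e\<^bsub>kk\<^esub>\<close> is an isomorphism of the relative commutant of \<open>A\<close> onto the corner of \<open>M\<close>
  at \<open>e\<^bsub>kk\<^esub>\<close>; its inverse copies an element \<open>q\<close> of the corner along the diagonal, to the sum of the \<open>e\<^bsub>ik\<^esub> q e\<^bsub>ki\<^esub>\<close>.
  A minimal projection \<open>p\<close> of the relative commutant would therefore make \<open>p e\<^bsub>kk\<^esub>\<close> a minimal, hence abelian, nonzero
  projection of \<open>M\<close>.\<close>

lemma relative_commutant_nonatomic:
  assumes nonab: "\<And>p. abelian_projection M p \<Longrightarrow> p = 0"
    and p: "p \<in> commuting_projections M A" "p \<noteq> 0"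
  shows "\<exists>q\<in>commuting_projections M A. op_le q p \<and> q \<noteq> 0 \<and> q \<noteq> p"
proof -
  obtain k :: 'm where True
    by blast
  have pM: "p \<in> M" "is_projection p" and pc: "\<And>a b. p o\<^sub>L unit_op a b = unit_op a b o\<^sub>L p"
    using p unit_op_in by (auto simp: commuting_projections_def)
  have pp: "p o\<^sub>L p = p" and pb: "p \<in> bounded_ops"
    using pM by (auto simp: is_projection_def)
  have kk: "is_projection (unit_op k k)"
    by (simp add: is_projection_def unit_op_in unit_op_mult cadj_unit_op)
  define f where "f = p o\<^sub>L unit_op k k"
  have f: "f \<in> M" "is_projection f"
    using vn_closure(3)[OF M pM(1) unit_op_in(2)] projection_compose[OF pM(2) kk pc] by (simp_all add: f_def)
  have "f \<noteq> 0"
  proof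
    assume f0: "f = 0"
    have "p o\<^sub>L unit_op a a = unit_op a k o\<^sub>L (f o\<^sub>L unit_op k a)" for a
    proof -
      have "unit_op a k o\<^sub>L (f o\<^sub>L unit_op k a) = unit_op a k o\<^sub>L (p o\<^sub>L unit_op k a)"
        by (simp add: f_def compose_assoc unit_op_mult)
      then show ?thesis
        by (simp add: pc unit_op_mult flip: compose_assoc)
    qed
    then have "p o\<^sub>L unit_op a a = 0" for a
      by (simp add: f0 compose_simps)
    then have "p o\<^sub>L (\<Sum>a\<in>UNIV. unit_op a a) = 0"
      by (simp add: compose_sum)
    then show False
      using p(2) by (simp add: sum_unit_op compose_simps)
  qed
  then have "\<not> abelian_projection M f"
    using nonab by blast
  then obtain q where q: "q \<in> M" "is_projection q" "op_le q f" "q \<noteq> 0" "q \<noteq> f"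
    using minimal_projection_abelian[OF M f] by blast
  have fq: "f o\<^sub>L q = q" "q o\<^sub>L f = q"
    using projection_le_commute[OF f(2) q(2,3)] by auto
  have qq: "q o\<^sub>L q = q" "cadj q = q" "q \<in> bounded_ops"
    using q(2) by (auto simp: is_projection_def)
  have ff: "p o\<^sub>L f = f" "unit_op k k o\<^sub>L f = f"
    by (simp add: f_def pp flip: compose_assoc) (simp add: f_def pc unit_op_mult')
  have pq: "p o\<^sub>L q = q" and kq: "unit_op k k o\<^sub>L q = q"
    using fq ff by (metis compose_assoc)+
  have "cadj (unit_op k k o\<^sub>L q) = q"
    using kq qq by simp
  then have qk: "q o\<^sub>L unit_op k k = q"
    by (simp add: cadj_compose unit_op_in qq cadj_unit_op)
  have qk': "q o\<^sub>L (unit_op k k o\<^sub>L T) = q o\<^sub>L T" and kq': "unit_op k k o\<^sub>L (q o\<^sub>L T) = q o\<^sub>L T"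
    and qq': "q o\<^sub>L (q o\<^sub>L T) = q o\<^sub>L T" for T :: "'h operator"
    by (simp_all add: qk kq qq flip: compose_assoc)
  define r where "r = (\<Sum>i\<in>UNIV. unit_op i k o\<^sub>L (q o\<^sub>L unit_op k i))"
  have rM: "r \<in> M"
    unfolding r_def by (intro vn_sum[OF M] vn_closure(3)[OF M] unit_op_in q)
  have rb: "r \<in> bounded_ops"
    by (rule vn_bounded[OF M rM])
  have ur: "unit_op a b o\<^sub>L r = unit_op a k o\<^sub>L (q o\<^sub>L unit_op k b)" for a b
    unfolding r_def compose_sum unit_op_mult' by simp
  have ru: "r o\<^sub>L unit_op a b = unit_op a k o\<^sub>L (q o\<^sub>L unit_op k b)" for a b
  proof -
    have "(unit_op i k o\<^sub>L (q o\<^sub>L unit_op k i)) o\<^sub>L unit_op a b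
        = (if i = a then unit_op a k o\<^sub>L (q o\<^sub>L unit_op k b) else 0)" for i
      by (simp add: compose_assoc unit_op_mult compose_simps)
    then show ?thesis
      unfolding r_def compose_sum by simp
  qed
  have rr: "r o\<^sub>L r = r"
  proof -
    have "r o\<^sub>L (unit_op i k o\<^sub>L (q o\<^sub>L unit_op k i)) = unit_op i k o\<^sub>L (q o\<^sub>L unit_op k i)" for i
    proof -
      have "r o\<^sub>L (unit_op i k o\<^sub>L (q o\<^sub>L unit_op k i)) = (r o\<^sub>L unit_op i k) o\<^sub>L (q o\<^sub>L unit_op k i)"
        by (simp add: compose_assoc)
      then show ?thesis
        unfolding ru by (simp add: compose_assoc kq' qq')
    qed
    then have "r o\<^sub>L (\<Sum>i\<in>UNIV. unit_op i k o\<^sub>L (q o\<^sub>L unit_op k i)) = (\<Sum>i\<in>UNIV. unit_op i k o\<^sub>L (q o\<^sub>L unit_op k i))"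
      unfolding compose_sum(2) by simp
    then show ?thesis
      by (simp only: r_def[symmetric])
  qed
  have "cadj r = (\<Sum>i\<in>UNIV. cadj (unit_op i k o\<^sub>L (q o\<^sub>L unit_op k i)))"
    unfolding r_def by (rule cadj_sum) (intro vn_closure(3)[OF M] unit_op_in q)
  also have "\<dots> = r"
    by (simp add: r_def cadj_compose bounded_ops_closure unit_op_in qq cadj_unit_op compose_assoc)
  finally have rp: "is_projection r"
    using rr rb by (simp add: is_projection_def)
  have rP: "r \<in> commuting_projections M A"
    using rM rp commutes_with_subalgebraI[OF rb] by (simp add: commuting_projections_def ur ru)
  have "p o\<^sub>L (unit_op i k o\<^sub>L (q o\<^sub>L unit_op k i)) = unit_op i k o\<^sub>L (q o\<^sub>L unit_op k i)" for i
  proof -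
    have "p o\<^sub>L (unit_op i k o\<^sub>L T) = unit_op i k o\<^sub>L (p o\<^sub>L T)" "p o\<^sub>L (q o\<^sub>L T) = q o\<^sub>L T" for T :: "'h operator"
      by (simp_all add: pc pq flip: compose_assoc)
    then show ?thesis
      by simp
  qed
  then have "p o\<^sub>L r = r"
    by (simp add: r_def compose_sum)
  then have le: "op_le r p"
    using projection_le_iff[OF pM(2) rp] by simp
  have "r o\<^sub>L unit_op k k = q"
    by (simp add: ru qk kq)
  then have "r \<noteq> 0" "r \<noteq> p"
    using q(4,5) by (auto simp: compose_simps f_def)
  then show ?thesis
    using rP le by blast
qed

text \<open>Moving \<open>x\<^sub>i\<close> past \<open>q\<^sub>j\<close> exhibits the factor \<open>q\<^sub>i q\<^sub>j\<close> in every mixed term.\<close>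

lemma glued_product:
  fixes x y :: "nat \<Rightarrow> 'h operator"
  assumes q: "\<And>j. j < n \<Longrightarrow> q j \<in> commuting_projections M A"
    and orth: "\<And>i j. i < n \<Longrightarrow> j < n \<Longrightarrow> i \<noteq> j \<Longrightarrow> q i o\<^sub>L q j = 0"
    and x: "\<And>j. j < n \<Longrightarrow> x j \<in> A"
  shows "(\<Sum>i<n. q i o\<^sub>L x i) o\<^sub>L (\<Sum>j<n. q j o\<^sub>L y j) = (\<Sum>j<n. q j o\<^sub>L (x j o\<^sub>L y j))"
proof -
  have "(q i o\<^sub>L x i) o\<^sub>L (q j o\<^sub>L y j) = (if i = j then q j o\<^sub>L (x j o\<^sub>L y j) else 0)" if "i < n" "j < n" for i j
  proof -
    have "(q i o\<^sub>L x i) o\<^sub>L (q j o\<^sub>L y j) = q i o\<^sub>L (x i o\<^sub>L q j) o\<^sub>L y j"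
      by (simp add: compose_assoc)
    also have "x i o\<^sub>L q j = q j o\<^sub>L x i"
      using q[OF that(2)] x[OF that(1)] by (simp add: commuting_projections_def)
    also have "q i o\<^sub>L (q j o\<^sub>L x i) o\<^sub>L y j = (q i o\<^sub>L q j) o\<^sub>L (x i o\<^sub>L y j)"
      by (simp add: compose_assoc)
    also have "\<dots> = (if i = j then q j o\<^sub>L (x j o\<^sub>L y j) else 0)"
      using orth[OF that] q[OF that(2)] by (simp add: compose_simps commuting_projections_def is_projection_def)
    finally show ?thesis .
  qed
  then have "(\<Sum>i<n. q i o\<^sub>L x i) o\<^sub>L (\<Sum>j<n. q j o\<^sub>L y j)
      = (\<Sum>i<n. \<Sum>j<n. if i = j then q j o\<^sub>L (x j o\<^sub>L y j) else 0)"
    unfolding compose_sum by (intro sum.cong) auto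
  then show ?thesis
    by simp
qed

text \<open>With \<open>w\<^sub>j\<close> running through the images of the signed permutation matrices and \<open>q\<^sub>j\<close> through an equal partition,
  \<open>u\<close> is the sum of the \<open>q\<^sub>j w\<^sub>j\<close>: conjugation by \<open>u\<close> performs the conjugation by \<open>w\<^sub>j\<close> on the piece \<open>q\<^sub>j\<close>, and the
  states weigh all pieces equally, so they see the average over the group.\<close>

theorem averaging_unitary_exists:
  assumes nonab: "\<And>p. abelian_projection M p \<Longrightarrow> p = 0"
    and \<tau>: "tracial_state_on M \<tau>"
    and I: "finite I" and \<phi>: "\<And>i. i \<in> I \<Longrightarrow> normal_state_on M (\<phi> i)"
  shows "\<exists>u\<in>M. is_unitary u \<and> (\<forall>i\<in>I. \<forall>a\<in>A. \<phi> i (Ad u a) = \<tau> a)"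
proof -
  let ?G = "signed_permutations :: (('m \<Rightarrow> 'm) \<times> ('m \<Rightarrow> bool)) set"
  define n where "n = card ?G"
  have n: "n > 0"
    using signed_permutations_finite signed_permutations_nonempty by (simp add: n_def card_gt_0_iff)
  obtain h where h: "bij_betw h {..<n} ?G"
    using ex_bij_betw_nat_finite[OF signed_permutations_finite] by (auto simp: n_def atLeast0LessThan)
  define U :: "nat \<Rightarrow> complex ^ 'm ^ 'm" where "U j = signed_permutation (h j)" for j
  have hG: "h j \<in> ?G" if "j < n" for j
    using h that by (auto simp: bij_betw_def)
  have UU: "matrix_star (U j) ** U j = mat 1" "U j ** matrix_star (U j) = mat 1" if "j < n" for j
    using signed_permutation_unitary[OF hG[OF that]] by (simp_all add: U_def)
  define w where "w j = \<pi> (U j)" for j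
  have wA: "w j \<in> A" "cadj (w j) \<in> A" and wM: "w j \<in> M" "cadj (w j) \<in> M" and wb: "w j \<in> bounded_ops" for j
    using pi_in subalgebra_cadj vn_cadj[OF M] by (simp_all add: w_def)
  have ww: "cadj (w j) o\<^sub>L w j = id_blinfun" "w j o\<^sub>L cadj (w j) = id_blinfun" if "j < n" for j
    using UU[OF that] pi_one by (simp_all add: w_def flip: pi_star pi_mult)
  have st: "state_on M (\<phi> i)" if "i \<in> I" for i
    using \<phi>[OF that] by (simp add: normal_state_on_def)

  define E where "E = (\<lambda>v. \<pi> (rank_one v)) ` (polarizing_vectors :: ('m \<Rightarrow> complex) set)"
  have E: "finite E" "E \<subseteq> A" "\<And>e. e \<in> E \<Longrightarrow> is_projection e"
    using finite_polarizing_vectors pi_in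
    by (auto simp: E_def is_projection_def rank_one_star rank_one_idem[OF polarizing_vectors_unit]
        simp flip: pi_mult pi_star)
  have "\<exists>q. (\<forall>j<n. q j \<in> commuting_projections M A) \<and> (\<forall>i<n. \<forall>j<n. i \<noteq> j \<longrightarrow> q i o\<^sub>L q j = 0) \<and>
    (\<Sum>j<n. q j) = id_blinfun \<and> (\<forall>j<n. \<forall>i\<in>I. \<forall>e\<in>E. \<phi> i (q j o\<^sub>L e) = \<phi> i e / of_nat n)"
    by (rule equal_partition_exists[OF M subalgebra_subset subalgebra_cadj relative_commutant_nonatomic[OF nonab] I \<phi> E n])
  then obtain q where "(\<forall>j<n. q j \<in> commuting_projections M A) \<and> (\<forall>i<n. \<forall>j<n. i \<noteq> j \<longrightarrow> q i o\<^sub>L q j = 0) \<and>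
    (\<Sum>j<n. q j) = id_blinfun \<and> (\<forall>j<n. \<forall>i\<in>I. \<forall>e\<in>E. \<phi> i (q j o\<^sub>L e) = \<phi> i e / of_nat n)" ..
  then have qP: "\<And>j. j < n \<Longrightarrow> q j \<in> commuting_projections M A"
    and orth: "\<And>i j. i < n \<Longrightarrow> j < n \<Longrightarrow> i \<noteq> j \<Longrightarrow> q i o\<^sub>L q j = 0"
    and sum_q: "(\<Sum>j<n. q j) = id_blinfun"
    and \<phi>E: "\<And>j i e. j < n \<Longrightarrow> i \<in> I \<Longrightarrow> e \<in> E \<Longrightarrow> \<phi> i (q j o\<^sub>L e) = \<phi> i e / of_nat n"
    by simp_all
  have qM: "q j \<in> M" "is_projection (q j)" "\<And>a. a \<in> A \<Longrightarrow> q j o\<^sub>L a = a o\<^sub>L q j" if "j < n" for j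
    using qP[OF that] by (auto simp: commuting_projections_def)
  have \<phi>A: "\<phi> i (q j o\<^sub>L \<pi> X) = \<phi> i (\<pi> X) / of_nat n" if j: "j < n" and i: "i \<in> I" for i j X
  proof (induction X rule: matrix_induct_rank_one)
    case (1 X Y)
    then show ?case
      using vn_closure(3)[OF M qM(1)[OF j] pi_in(2)]
      by (simp add: pi_add compose_simps state_linear(1)[OF M st[OF i]] pi_in add_divide_distrib)
  next
    case (2 c X)
    then show ?case
      using vn_closure(3)[OF M qM(1)[OF j] pi_in(2)] vn_bounded[OF M qM(1)[OF j]]
      by (simp add: pi_scale compose_scaleC_right state_linear(3)[OF M st[OF i]] pi_in)
  next
    case (3 v)
    then show ?case
      using \<phi>E[OF j i, of "\<pi> (rank_one v)"] by (simp add: E_def)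
  qed

  define u where "u = (\<Sum>j<n. q j o\<^sub>L w j)"
  have uM: "u \<in> M"
    unfolding u_def using vn_closure(3)[OF M] qM wM by (intro vn_sum[OF M]) auto
  have adj_u: "cadj u = (\<Sum>j<n. q j o\<^sub>L cadj (w j))"
  proof -
    have "cadj (q j o\<^sub>L w j) = q j o\<^sub>L cadj (w j)" if "j < n" for j
      using qM[OF that] wb wA by (simp add: cadj_compose is_projection_def)
    then show ?thesis
      unfolding u_def using vn_closure(3)[OF M] qM wM by (subst cadj_sum) auto
  qed
  have conj: "Ad u a = (\<Sum>j<n. q j o\<^sub>L (cadj (w j) o\<^sub>L a o\<^sub>L w j))" if a: "a \<in> A" for a
  proof -
    have "a o\<^sub>L u = (\<Sum>j<n. q j o\<^sub>L (a o\<^sub>L w j))"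
    proof -
      have "a o\<^sub>L (q j o\<^sub>L w j) = q j o\<^sub>L (a o\<^sub>L w j)" if "j < n" for j
        using qM(3)[OF that a] by (metis compose_assoc)
      then show ?thesis
        by (simp add: u_def compose_sum)
    qed
    then have "cadj u o\<^sub>L (a o\<^sub>L u) = (\<Sum>j<n. q j o\<^sub>L (cadj (w j) o\<^sub>L (a o\<^sub>L w j)))"
      unfolding adj_u by (simp add: glued_product[OF qP orth wA(2)])
    then show ?thesis
      by (simp add: Ad_def compose_assoc)
  qed
  have "cadj u o\<^sub>L u = id_blinfun"
  proof -
    have "cadj u o\<^sub>L u = (\<Sum>j<n. q j o\<^sub>L (cadj (w j) o\<^sub>L w j))"
      unfolding adj_u unfolding u_def by (rule glued_product[OF qP orth wA(2)])
    then show ?thesis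
      using sum_q by (simp add: ww compose_simps)
  qed
  moreover have "u o\<^sub>L cadj u = id_blinfun"
  proof -
    have "u o\<^sub>L cadj u = (\<Sum>j<n. q j o\<^sub>L (w j o\<^sub>L cadj (w j)))"
      unfolding adj_u unfolding u_def by (rule glued_product[OF qP orth wA(1)])
    then show ?thesis
      using sum_q by (simp add: ww compose_simps)
  qed
  ultimately have "is_unitary u"
    using vn_bounded[OF M uM] by (simp add: is_unitary_def)
  moreover have "\<phi> i (Ad u a) = \<tau> a" if i: "i \<in> I" and a: "a \<in> A" for i a
  proof -
    have \<tau>s: "state_on M \<tau>" and tr: "\<And>x y. x \<in> M \<Longrightarrow> y \<in> M \<Longrightarrow> \<tau> (x o\<^sub>L y) = \<tau> (y o\<^sub>L x)"
      using \<tau> by (auto simp: tracial_state_on_def)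
    obtain X where X: "a = \<pi> X"
      using pi_surj[OF a] by blast
    define Y where "Y j = matrix_star (U j) ** X ** U j" for j
    have Y: "cadj (w j) o\<^sub>L a o\<^sub>L w j = \<pi> (Y j)" for j
      by (simp add: Y_def w_def X pi_mult pi_star)
    obtain c where "(\<Sum>g\<in>?G. matrix_star (signed_permutation g) ** X ** signed_permutation g) = matrix_scale c (mat 1)"
      using signed_permutation_average by blast
    then have c: "(\<Sum>j<n. Y j) = matrix_scale c (mat 1)"
      using sum.reindex_bij_betw[OF h, of "\<lambda>g. matrix_star (signed_permutation g) ** X ** signed_permutation g"]
      by (simp add: Y_def U_def)
    \<comment> \<open>The conjugates of \<open>a\<close> add up to the scalar \<open>c\<close>, so every state, \<open>\<tau>\<close> as well as \<open>\<phi> i\<close>, sees only \<open>c\<close>.\<close>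
    have avg: "(\<Sum>j<n. \<rho> (\<pi> (Y j))) = c" if \<rho>: "state_on M \<rho>" for \<rho>
    proof -
      have "(\<Sum>j<n. \<rho> (\<pi> (Y j))) = \<rho> (\<pi> (\<Sum>j<n. Y j))"
        by (simp add: pi_sum state_sum[OF M \<rho>] pi_in)
      also have "\<dots> = c * \<rho> id_blinfun"
        unfolding c pi_scale pi_one by (rule state_linear(3)[OF M \<rho> vn_zero_id(2)[OF M]])
      finally show ?thesis
        using \<rho> by (simp add: state_on_def)
    qed
    have "\<tau> (\<pi> (Y j)) = \<tau> a" if "j < n" for j
    proof -
      have "\<tau> ((cadj (w j) o\<^sub>L a) o\<^sub>L w j) = \<tau> (w j o\<^sub>L (cadj (w j) o\<^sub>L a))"
        using a subalgebra_subset by (intro tr vn_closure(3)[OF M] wM) auto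
      also have "w j o\<^sub>L (cadj (w j) o\<^sub>L a) = a"
        using ww(2)[OF that] by (simp add: compose_simps flip: compose_assoc)
      finally show ?thesis
        by (simp add: Y)
    qed
    then have "of_nat n * \<tau> a = c"
      using avg[OF \<tau>s] by simp
    moreover have "\<phi> i (Ad u a) = c / of_nat n"
    proof -
      have "\<phi> i (Ad u a) = (\<Sum>j<n. \<phi> i (q j o\<^sub>L \<pi> (Y j)))"
        unfolding conj[OF a] Y
        using vn_closure(3)[OF M qM(1) pi_in(2)] by (intro state_sum[OF M st[OF i]]) auto
      also have "\<dots> = (\<Sum>j<n. \<phi> i (\<pi> (Y j))) / of_nat n"
        using \<phi>A i by (simp add: sum_divide_distrib)
      finally show ?thesis
        using avg[OF st[OF i]] by simp
    qed
    ultimately show ?thesis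
      using n by (auto simp: field_simps)
  qed
  ultimately show ?thesis
    using uM by blast
qed

end

theorem theorem4p1:
  fixes M A :: "'h::complex_hilbert operator set"
    and \<tau> :: "'h operator \<Rightarrow> complex"
    and \<phi> :: "nat \<Rightarrow> 'h operator \<Rightarrow> complex"
    and k :: nat
  assumes "type_II1_factor M"
    and "tracial_state_on M \<tau>"
    and "\<And>i. i \<in> {1..k} \<Longrightarrow> normal_state_on M (\<phi> i)"
    and "cstar_subalgebra A M"
    and "\<exists>\<pi> :: complex ^ 'm ^ 'm \<Rightarrow> 'h operator. matrix_star_iso \<pi> A"
    and "id_blinfun \<in> A"
  shows "\<exists>u\<in>M. is_unitary u \<and> (\<forall>i\<in>{1..k}. \<forall>a\<in>A. (\<phi> i \<circ> Ad u) a = \<tau> a)"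
proof -
  obtain \<pi> :: "complex ^ 'm ^ 'm \<Rightarrow> 'h operator" where "matrix_star_iso \<pi> A"
    using assms(5) by blast
  then have "unital_matrix_subalgebra M A \<pi>"
    using assms(1,4,6) by (simp add: unital_matrix_subalgebra_def type_II1_factor_def factor_def)
  moreover have "p = 0" if "abelian_projection M p" for p
    using assms(1) that by (simp add: type_II1_factor_def)
  ultimately show ?thesis
    using unital_matrix_subalgebra.averaging_unitary_exists[OF _ _ assms(2) finite_atLeastAtMost assms(3)]
    by simp
qed

end
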